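(* Let $m_1,m_2,n\in\mathbb{N}$, and let $\alpha$, $\Sigma_0$, $\vartheta_1$, $\vartheta_2$ be complex matrices of sizes $n\times n$, $n\times n$, $n\times m_1$, $n\times m_2$, respectively, such that $$\Sigma_0>0,\qquad \alpha\Sigma_0-\Sigma_0\alpha^*=\mathrm{i}(\vartheta_1\vartheta_1^*-\vartheta_2\vartheta_2^* ).$$ For $x\ge 0$ put $$\Lambda(x)=\begin{bmatrix}\mathrm{e}^{-\mathrm{i}x\alpha}\vartheta_1&\mathrm{e}^{\mathrm{i}x\alpha}\vartheta_2\end{bmatrix},\qquad \Sigma(x)=\Sigma_0+\int_0^x\Lambda(t)\Lambda(t)^*dt,$$ $$v(x)=-2\mathrm{i}\,\vartheta_1^*\,\mathrm{e}^{\mathrm{i}x\alpha^*}\Sigma(x)^{-1}\mathrm{e}^{\mathrm{i}x\alpha}\vartheta_2 .$$ Consider the Dirac system on $[0,\infty)$ with this potential $v$: $$\frac{d}{dx}y(x,z)=\mathrm{i}\,(zj+jV(x))\,y(x,z)\quad (x\ge 0),\qquad j=\begin{bmatrix} I_{m_1}&0\\ 0&-I_{m_2}\end{bmatrix},\quad V=\begin{bmatrix}0&v\\ v^*&0\end{bmatrix}.$$ Then the Weyl function $\varphi$ of this system has the form $$\varphi(z)=-\mathrm{i}\,\vartheta_2^*\Sigma_0^{-1}(zI_n-\theta)^{-1}\vartheta_1,\qquad \theta=\alpha-\mathrm{i}\,\vartheta_1\vartheta_1^*\Sigma_0^{-1}.$$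
   Context: $\mathbb{C}_+$ is the open upper half-plane, $m:=m_1+m_2$. Let $u(x,z)$ denote the fundamental ($m\times m$) solution of the Dirac system normalized by $u(0,z)=I_m$. An $m\times m_1$ matrix function $\mathcal{P}(z)$, meromorphic in $\mathbb{C}_+$, is called nonsingular with property-$j$ if, for all $z\in\mathbb{C}_+$ excluding possibly a discrete set of points, $\mathcal{P}(z)^*\mathcal{P}(z)>0$ and $\mathcal{P}(z)^*j\mathcal{P}(z)\ge 0$. For $x\ge0$, $z\in\mathbb{C}_+$, $\mathcal{N}(x,z)$ is the set of values at $x,z$ of the matrix functions $$\varphi(x,z,\mathcal{P})=\begin{bmatrix}0&I_{m_2}\end{bmatrix}u(x,z)^{-1}\mathcal{P}(z)\Big(\begin{bmatrix}I_{m_1}&0\end{bmatrix}u(x,z)^{-1}\mathcal{P}(z)\Big)^{-1},$$ where $\mathcal{P}$ runs over the nonsingular matrix functions with property-$j$ (for given $z$, those $\mathcal{P}$ for which $z$ is not in the exceptional discrete set); the inverse always exists. The Weyl (Weyl-Titchmarsh) function of a Dirac system with measurable, locally summable potential $v$ is the $m_2\times m_1$ matrix function $\varphi$ on $\mathbb{C}_+$ determined by $\{\varphi(z)\}=\bigcap_{0\le x<\infty}\mathcal{N}(x,z)$, $z\in\mathbb{C}_+$; it is known that this intersection is always a single point and that $\varphi$ is analytic and non-expansive ($\varphi^*\varphi\le I_{m_1}$) in $\mathbb{C}_+$. Potentials of the form $v(x)=-2\mathrm{i}\,\vartheta_1^*\,\mathrm{e}^{\mathrm{i}x\alpha^*}\Sigma(x)^{-1}\mathrm{e}^{\mathrm{i}x\alpha}\vartheta_2$,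 where $\Sigma(x)=\Sigma_0+\int_0^x\Lambda(t)\Lambda(t)^*dt$, $\Lambda(x)=\begin{bmatrix}\mathrm{e}^{-\mathrm{i}x\alpha}\vartheta_1&\mathrm{e}^{\mathrm{i}x\alpha}\vartheta_2\end{bmatrix}$, $\Sigma_0>0$ and $\alpha\Sigma_0-\Sigma_0\alpha^*=\mathrm{i}(\vartheta_1\vartheta_1^*-\vartheta_2\vartheta_2^* )$, are called generalized pseudo-exponential potentials generated by $\alpha,\Sigma_0,\vartheta_1,\vartheta_2$. *)

theory Defs
  imports "HOL-Complex_Analysis.Complex_Analysis"
begin

text \<open>
  A complex \<open>p \<times> q\<close> matrix has type \<open>complex^'q^'p\<close>; block matrices of
  order \<open>m = m\<^sub>1 + m\<^sub>2\<close> are indexed by the sum type \<open>'m1 + 'm2\<close>.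
\<close>

definition cscale :: "complex \<Rightarrow> complex^'q^'p \<Rightarrow> complex^'q^'p" where
  "cscale c A = (\<chi> i k. c * A $ i $ k)"

definition ctranspose :: "complex^'q^'p \<Rightarrow> complex^'p^'q" (\<open>(_\<^sup>\<dagger>)\<close> [1000] 1000) where
  "A\<^sup>\<dagger> = (\<chi> i k. cnj (A $ k $ i))"

definition sesq_form :: "complex^'p^'p \<Rightarrow> complex^'p \<Rightarrow> complex" where
  "sesq_form A x = (\<Sum>i\<in>UNIV. cnj (x $ i) * (A *v x) $ i)"

text \<open>For Hermitian \<open>A\<close> the form is real, so taking \<open>Re\<close> loses nothing.\<close>

definition pos_def :: "complex^'p^'p \<Rightarrow> bool" where
  "pos_def A \<longleftrightarrow> A\<^sup>\<dagger> = A \<and> (\<forall>x. x \<noteq> 0 \<longrightarrow> 0 < Re (sesq_form A x))"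

definition pos_semidef :: "complex^'p^'p \<Rightarrow> bool" where
  "pos_semidef A \<longleftrightarrow> A\<^sup>\<dagger> = A \<and> (\<forall>x. 0 \<le> Re (sesq_form A x))"

definition hcat :: "complex^'a^'p \<Rightarrow> complex^'b^'p \<Rightarrow> complex^('a + 'b)^'p" where
  "hcat A B = (\<chi> i k. case k of Inl a \<Rightarrow> A $ i $ a | Inr b \<Rightarrow> B $ i $ b)"

definition vcat :: "complex^'q^'a \<Rightarrow> complex^'q^'b \<Rightarrow> complex^'q^('a + 'b)" where
  "vcat A B = (\<chi> i. case i of Inl a \<Rightarrow> A $ a | Inr b \<Rightarrow> B $ b)"

text \<open>
  The multiplication of the type class on \<open>complex^'p^'p\<close> is componentwise, so the
  library's \<^const>\<open>power\<close> and \<^const>\<open>exp\<close> are not the matrix ones.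
\<close>

primrec mat_pow :: "complex^'p^'p \<Rightarrow> nat \<Rightarrow> complex^'p^'p" where
  "mat_pow A 0 = mat 1"
| "mat_pow A (Suc k) = A ** mat_pow A k"

definition mat_exp :: "complex^'p^'p \<Rightarrow> complex^'p^'p" where
  "mat_exp A = (\<Sum>k. mat_pow A k /\<^sub>R fact k)"

definition upper_half_plane :: "complex set" (\<open>\<complex>\<^sub>+\<close>) where
  "\<complex>\<^sub>+ = {z. 0 < Im z}"

definition dirac_j :: "complex^('m1::finite + 'm2::finite)^('m1 + 'm2)" where
  "dirac_j = vcat (hcat (mat 1) 0) (hcat 0 (- mat 1))"

definition dirac_V :: "complex^'m2^'m1 \<Rightarrow> complex^('m1 + 'm2)^('m1 + 'm2)" where
  "dirac_V w = vcat (hcat 0 w) (hcat (w\<^sup>\<dagger>) 0)"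

text \<open>
  The derivative is the classical one, which is the appropriate notion for continuous
  potentials \<open>v\<close>; at \<open>x = 0\<close> it is one-sided.
\<close>

definition dirac_fundamental_solution ::
    "(real \<Rightarrow> complex^'m2^'m1) \<Rightarrow> (real \<Rightarrow> complex \<Rightarrow> complex^('m1 + 'm2)^('m1 + 'm2)) \<Rightarrow> bool" where
  "dirac_fundamental_solution v u \<longleftrightarrow>
     (\<forall>z. u 0 z = mat 1 \<and>
       (\<forall>x\<ge>0. ((\<lambda>x. u x z) has_vector_derivative
          cscale \<i> (cscale z dirac_j + dirac_j ** dirac_V (v x)) ** u x z) (at x within {0..})))"

definition nonsingular_j_at :: "complex^'m1^('m1 + 'm2::finite) \<Rightarrow> bool" where
  "nonsingular_j_at P \<longleftrightarrow> pos_def (P\<^sup>\<dagger> ** P) \<and> pos_semidef (P\<^sup>\<dagger> ** dirac_j ** P)"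

definition nonsingular_property_j :: "(complex \<Rightarrow> complex^'m1^('m1 + 'm2::finite)) \<Rightarrow> bool" where
  "nonsingular_property_j P \<longleftrightarrow>
     (\<forall>i k. (\<lambda>z. P z $ i $ k) meromorphic_on \<complex>\<^sub>+) \<and>
     (\<forall>\<^sub>\<approx>z\<in>\<complex>\<^sub>+. nonsingular_j_at (P z))"

text \<open>
  A function that is \<open>meromorphic_on\<close> a set may take arbitrary values at isolated points.
  The exceptional points of \<open>P\<close> are therefore those where \<open>P\<close> is not analytic, together
  with those where one of the two matrix inequalities fails.
\<close>

definition non_exceptional :: "(complex \<Rightarrow> complex^'m1^('m1 + 'm2::finite)) \<Rightarrow> complex \<Rightarrow> bool" where
  "non_exceptional P z \<longleftrightarrow>
     (\<forall>i k. (\<lambda>w. P w $ i $ k) analytic_on {z}) \<and> nonsingular_j_at (P z)"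

definition weyl_transform ::
    "(real \<Rightarrow> complex \<Rightarrow> complex^('m1 + 'm2)^('m1 + 'm2)) \<Rightarrow> real \<Rightarrow> complex
      \<Rightarrow> (complex \<Rightarrow> complex^'m1^('m1 + 'm2)) \<Rightarrow> complex^'m1^'m2" where
  "weyl_transform u x z P =
     (hcat 0 (mat 1) ** matrix_inv (u x z) ** P z) **
     matrix_inv (hcat (mat 1) 0 ** matrix_inv (u x z) ** P z)"

definition weyl_set ::
    "(real \<Rightarrow> complex \<Rightarrow> complex^('m1 + 'm2)^('m1 + 'm2)) \<Rightarrow> real \<Rightarrow> complex
      \<Rightarrow> (complex^'m1^'m2) set" where
  "weyl_set u x z = {weyl_transform u x z P | P. nonsingular_property_j P \<and> non_exceptional P z}"

definition is_weyl_function ::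
    "(real \<Rightarrow> complex^'m2^'m1) \<Rightarrow> (complex \<Rightarrow> complex^'m1^'m2) \<Rightarrow> bool" where
  "is_weyl_function v \<phi> \<longleftrightarrow>
     (\<exists>u. dirac_fundamental_solution v u \<and>
       (\<forall>z\<in>\<complex>\<^sub>+. {\<phi> z} = (\<Inter>x\<in>{0..}. weyl_set u x z)))"

definition gpe_Lambda ::
    "complex^'n^'n \<Rightarrow> complex^'m1^'n \<Rightarrow> complex^'m2^'n \<Rightarrow> real \<Rightarrow> complex^('m1 + 'm2)^'n" where
  "gpe_Lambda \<alpha> \<theta>1 \<theta>2 x =
     hcat (mat_exp (cscale (- \<i> * of_real x) \<alpha>) ** \<theta>1) (mat_exp (cscale (\<i> * of_real x) \<alpha>) ** \<theta>2)"

definition gpe_Sigma ::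
    "complex^'n^'n \<Rightarrow> complex^'n^'n \<Rightarrow> complex^'m1^'n \<Rightarrow> complex^'m2^'n \<Rightarrow> real \<Rightarrow> complex^'n^'n" where
  "gpe_Sigma \<alpha> \<Sigma>0 \<theta>1 \<theta>2 x =
     \<Sigma>0 + integral {0..x} (\<lambda>t. gpe_Lambda \<alpha> \<theta>1 \<theta>2 t ** (gpe_Lambda \<alpha> \<theta>1 \<theta>2 t)\<^sup>\<dagger>)"

definition gpe_potential ::
    "complex^'n^'n \<Rightarrow> complex^'n^'n \<Rightarrow> complex^'m1^'n \<Rightarrow> complex^'m2^'n \<Rightarrow> real \<Rightarrow> complex^'m2^'m1" where
  "gpe_potential \<alpha> \<Sigma>0 \<theta>1 \<theta>2 x =
     cscale (- 2 * \<i>)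
       (\<theta>1\<^sup>\<dagger> ** mat_exp (cscale (\<i> * of_real x) (\<alpha>\<^sup>\<dagger>)) ** matrix_inv (gpe_Sigma \<alpha> \<Sigma>0 \<theta>1 \<theta>2 x)
        ** mat_exp (cscale (\<i> * of_real x) \<alpha>) ** \<theta>2)"

end

theory Submission
  imports Defs
begin

text \<open>
  With the real inner product \<open>x \<bullet> y = Re (x\<^sup>\<dagger> y)\<close>, solutions \<open>y\<close> and \<open>w\<close> of the Dirac system with
  spectral parameters \<open>z\<close> and \<open>\<zeta>\<close> satisfy \<open>(w \<bullet> j y)' = w \<bullet> (\<i> (z - cnj \<zeta>) y)\<close>. For \<open>\<zeta> = cnj z\<close> the
  form is constant, which gives invertibility of \<open>u\<close> and uniqueness of solutions; for \<open>\<zeta> = z\<close> it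
  shows that \<open>y \<bullet> j y\<close> decreases at the rate \<open>2 Im z |y|\<^sup>2\<close>. Hence \<open>\<phi>\<close> belongs to the Weyl set at \<open>x\<close> iff
  the columns of \<open>u(x,z) [I; \<phi>]\<close> are \<open>j\<close>-nonnegative, and at most one \<open>\<phi>\<close> belongs to all of them.

  The identity \<open>\<alpha> \<Sigma> - \<Sigma> \<alpha>\<^sup>\<dagger> = \<i> \<Lambda> j \<Lambda>\<^sup>\<dagger>\<close> propagates from \<open>x = 0\<close> to all \<open>x\<close>, and the GBDT (Darboux)
  formula gives \<open>u(x,z) [I; \<phi>]\<close> explicitly for the claimed \<open>\<phi>\<close>; the same identity shows that its
  columns are \<open>j\<close>-nonnegative.
\<close>

no_notation fps_nth (infixl \<open>$\<close> 75)

subsection \<open>Complex matrices and the real inner product\<close>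

lemma matrix_eqI: "(\<And>x. A *v x = B *v x) \<Longrightarrow> A = (B :: complex^'q^'p)"
  by (simp add: matrix_eq)

lemma cscale_apply [simp]: "cscale c A *v x = c *s (A *v x)"
  by (simp add: cscale_def matrix_vector_mult_def vector_scalar_mult_def vec_eq_iff
      sum_distrib_left mult.assoc)

lemma cscale_0 [simp]: "cscale 0 A = 0"
  by (simp add: cscale_def vec_eq_iff)

lemma mat_apply [simp]: "mat z *v x = z *s (x :: complex^'p)"
  by (simp add: mat_def matrix_vector_mult_def vector_scalar_mult_def vec_eq_iff if_distrib
      if_distribR cong: if_cong)

lemma minus_apply [simp]: "(- A) *v x = - (A *v (x :: complex^'q))"
  by (simp add: matrix_vector_mult_def vec_eq_iff sum_negf)

lemma apply_minus [simp]: "A *v (- x) = - (A *v (x :: complex^'q))"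
  by (simp add: matrix_vector_mult_def vec_eq_iff sum_negf)

lemma apply_scale [simp]: "A *v (c *s x) = c *s (A *v (x :: complex^'q))"
  by (simp add: matrix_vector_mult_def vector_scalar_mult_def vec_eq_iff
      sum_distrib_left algebra_simps)

lemma mult_apply [simp]: "(A ** B) *v x = A *v (B *v (x :: complex^'q))"
  by (simp add: matrix_vector_mul_assoc)

lemma ctranspose_ctranspose [simp]: "(A\<^sup>\<dagger>)\<^sup>\<dagger> = A"
  by (simp add: ctranspose_def vec_eq_iff)

lemma ctranspose_mult: "(A ** B)\<^sup>\<dagger> = B\<^sup>\<dagger> ** A\<^sup>\<dagger>"
  by (simp add: ctranspose_def matrix_matrix_mult_def vec_eq_iff mult.commute)

lemma ctranspose_mat_1 [simp]: "(mat 1 :: complex^'p^'p)\<^sup>\<dagger> = mat 1"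
  by (auto simp: ctranspose_def mat_def vec_eq_iff)

lemma ctranspose_cscale [simp]: "(cscale c A)\<^sup>\<dagger> = cscale (cnj c) (A\<^sup>\<dagger>)"
  by (simp add: ctranspose_def cscale_def vec_eq_iff)

lemma inner_cscale_left: "(c *s x) \<bullet> y = x \<bullet> (cnj c *s (y :: complex^'p))"
  by (simp add: inner_vec_def vector_scalar_mult_def inner_complex_def algebra_simps)

lemma inner_apply_left: "(A *v x) \<bullet> y = x \<bullet> (A\<^sup>\<dagger> *v (y :: complex^'p))"
proof -
  have "(A *v x) \<bullet> y = (\<Sum>i\<in>UNIV. \<Sum>k\<in>UNIV. (A $ i $ k * x $ k) \<bullet> y $ i)"
    by (simp add: inner_vec_def matrix_vector_mult_def inner_sum_left)
  also have "\<dots> = (\<Sum>k\<in>UNIV. \<Sum>i\<in>UNIV. x $ k \<bullet> (cnj (A $ i $ k) * y $ i))"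
    by (subst sum.swap) (simp add: inner_complex_def algebra_simps)
  also have "\<dots> = x \<bullet> (A\<^sup>\<dagger> *v y)"
    by (simp add: inner_vec_def matrix_vector_mult_def inner_sum_right ctranspose_def)
  finally show ?thesis .
qed

lemma Re_sesq_form: "Re (sesq_form A x) = x \<bullet> (A *v x)"
  by (simp add: sesq_form_def inner_vec_def inner_complex_def)

lemma cscale_real: "complex_of_real r *s x = r *\<^sub>R (x :: complex^'p)"
  by (simp add: vector_scalar_mult_def vec_eq_iff flip: scaleR_conv_of_real)

text \<open>The quadratic form of a Hermitian matrix is real, so multiplying it by \<i> leaves no
  real part. Moving \<open>A\<close> and the scalar across the inner product changes the sign
  exactly once.\<close>

lemma inner_i_hermitian:
  assumes "A\<^sup>\<dagger> = A"
  shows "x \<bullet> (\<i> *s (A *v x)) = 0"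
proof -
  have "x \<bullet> (\<i> *s (A *v x)) = (A *v (-\<i> *s x)) \<bullet> x"
    by (simp add: inner_apply_left assms inner_cscale_left flip: minus_apply)
  also have "\<dots> = - (x \<bullet> (\<i> *s (A *v x)))"
    by (simp add: inner_commute)
  finally show ?thesis by simp
qed

lemma invertible_if_ker_trivial:
  fixes A :: "complex^'p^'p"
  assumes "\<And>x. A *v x = 0 \<Longrightarrow> x = 0"
  shows "invertible A"
  using assms by (auto simp: invertible_left_inverse matrix_left_invertible_ker)

lemma matrix_inv_mult:
  fixes A :: "complex^'p^'p"
  assumes "invertible A"
  shows "A ** matrix_inv A = mat 1" "matrix_inv A ** A = mat 1"
proof -
  have "A ** matrix_inv A = mat 1 \<and> matrix_inv A ** A = mat 1"
    using assms unfolding invertible_def matrix_inv_def by (rule someI_ex)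
  then show "A ** matrix_inv A = mat 1" "matrix_inv A ** A = mat 1" by auto
qed

lemma matrix_inv_apply:
  fixes A :: "complex^'p^'p"
  assumes "invertible A"
  shows "A *v (matrix_inv A *v x) = x" "matrix_inv A *v (A *v x) = x"
  using matrix_inv_mult[OF assms] by (metis matrix_vector_mul_assoc matrix_vector_mul_lid)+

lemma matrix_inv_unique:
  fixes A :: "complex^'p^'p"
  assumes "A ** B = mat 1"
  shows "matrix_inv A = B"
proof -
  have "invertible A" using assms invertible_right_inverse by blast
  then have "matrix_inv A ** (A ** B) = B"
    by (simp add: matrix_mul_assoc matrix_inv_mult)
  with assms show ?thesis by simp
qed

lemma pos_def_invertible: "pos_def A \<Longrightarrow> invertible A"
  by (rule invertible_if_ker_trivial) (metis Re_sesq_form inner_zero_right less_irrefl pos_def_def)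

lemma ctranspose_matrix_inv:
  assumes "invertible A" "A\<^sup>\<dagger> = A"
  shows "(matrix_inv A)\<^sup>\<dagger> = matrix_inv A"
proof -
  have "A ** (matrix_inv A)\<^sup>\<dagger> = mat 1"
    by (metis assms ctranspose_mult ctranspose_mat_1 matrix_inv_mult(2))
  then show ?thesis by (metis matrix_inv_unique)
qed

section \<open>Bounded linear and bilinear matrix operations\<close>

lemma bounded_bilinear_matrix_mult:
  "bounded_bilinear ((**) :: complex^'q^'p \<Rightarrow> complex^'r^'q \<Rightarrow> complex^'r^'p)"
  unfolding bilinear_conv_bounded_bilinear[symmetric] bilinear_def
  by (auto intro!: linearI simp: matrix_matrix_mult_def vec_eq_iff sum.distrib
      scaleR_sum_right distrib_left distrib_right)

lemma bounded_bilinear_matrix_apply: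
  "bounded_bilinear ((*v) :: complex^'q^'p \<Rightarrow> complex^'q \<Rightarrow> complex^'p)"
  unfolding bilinear_conv_bounded_bilinear[symmetric] bilinear_def
  by (auto intro!: linearI simp: matrix_vector_mult_def vec_eq_iff sum.distrib
      scaleR_sum_right distrib_left distrib_right)

lemma bounded_bilinear_scale: "bounded_bilinear ((*s) :: complex \<Rightarrow> complex^'p \<Rightarrow> complex^'p)"
  unfolding bilinear_conv_bounded_bilinear[symmetric] bilinear_def
  by (auto intro!: linearI simp: vector_scalar_mult_def vec_eq_iff algebra_simps)

lemma bounded_linear_cscale: "bounded_linear (cscale c :: complex^'q^'p \<Rightarrow> _)"
  unfolding linear_conv_bounded_linear[symmetric]
  by (auto intro!: linearI simp: cscale_def vec_eq_iff algebra_simps)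

lemma bounded_linear_ctranspose: "bounded_linear (ctranspose :: complex^'q^'p \<Rightarrow> _)"
  unfolding linear_conv_bounded_linear[symmetric]
  by (auto intro!: linearI simp: ctranspose_def vec_eq_iff)

subsection \<open>Block matrices and the signature matrix\<close>

lemma sum_UNIV_Plus:
  fixes f :: "'a::finite + 'b::finite \<Rightarrow> 'c::comm_monoid_add"
  shows "(\<Sum>k\<in>UNIV. f k) = (\<Sum>a\<in>UNIV. f (Inl a)) + (\<Sum>b\<in>UNIV. f (Inr b))"
  by (simp add: UNIV_Plus_UNIV[symmetric] sum.Plus del: UNIV_Plus_UNIV)

lemma ctranspose_hcat: "(hcat A B)\<^sup>\<dagger> = vcat (A\<^sup>\<dagger>) (B\<^sup>\<dagger>)"
  by (auto simp: ctranspose_def hcat_def vcat_def vec_eq_iff split: sum.split)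

lemma vcat_mult: "vcat A B ** C = vcat (A ** C) (B ** C)"
  by (auto simp: vcat_def matrix_matrix_mult_def vec_eq_iff split: sum.split)

lemma mult_hcat: "A ** hcat B C = hcat (A ** B) (A ** C)"
  by (auto simp: hcat_def matrix_matrix_mult_def vec_eq_iff split: sum.split)

lemma hcat_vcat: "hcat A B ** vcat C D = A ** C + B ** D"
  by (simp add: hcat_def vcat_def matrix_matrix_mult_def vec_eq_iff sum_UNIV_Plus)

lemma vcat_apply: "vcat A B *v x = (\<chi> i. case i of Inl a \<Rightarrow> (A *v x) $ a | Inr b \<Rightarrow> (B *v x) $ b)"
  by (auto simp: vcat_def matrix_vector_mult_def vec_eq_iff split: sum.split)

lemma vcat_apply_diff:
  "vcat A B *v x - vcat C D *v y =
   (\<chi> i. case i of Inl a \<Rightarrow> (A *v x - C *v y) $ a | Inr b \<Rightarrow> (B *v x - D *v y) $ b)"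
  by (auto simp: vcat_apply vec_eq_iff split: sum.split)

lemma hcat_apply: "hcat A B *v x = A *v (\<chi> a. x $ Inl a) + B *v (\<chi> b. x $ Inr b)"
  by (simp add: hcat_def matrix_vector_mult_def vec_eq_iff sum_UNIV_Plus)

lemma dirac_j_apply: "dirac_j *v x = (\<chi> i. case i of Inl a \<Rightarrow> x $ Inl a | Inr b \<Rightarrow> - x $ Inr b)"
  by (auto simp: dirac_j_def vcat_apply hcat_apply vec_eq_iff split: sum.split)

lemma dirac_j_apply_twice [simp]: "dirac_j *v (dirac_j *v x) = x"
  by (auto simp: dirac_j_apply vec_eq_iff split: sum.split)

lemma ctranspose_dirac_j [simp]: "dirac_j\<^sup>\<dagger> = dirac_j"
  by (auto simp: dirac_j_def ctranspose_def vcat_def hcat_def mat_def vec_eq_iff split: sum.split)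

lemma inner_dirac_j:
  "(dirac_j *v x) \<bullet> (dirac_j *v y) = x \<bullet> y" "(dirac_j *v x) \<bullet> y = x \<bullet> (dirac_j *v y)"
  by (simp_all add: inner_apply_left)

lemma dirac_form:
  "x \<bullet> (dirac_j *v x) = (norm (\<chi> a. x $ Inl a))\<^sup>2 - (norm (\<chi> b. x $ Inr b))\<^sup>2"
  unfolding power2_norm_eq_inner
  by (simp add: inner_vec_def dirac_j_apply sum_UNIV_Plus sum_negf)

lemma norm_block:
  "(norm x)\<^sup>2 = (norm (\<chi> a. x $ Inl a))\<^sup>2 + (norm (\<chi> b. x $ Inr b))\<^sup>2"
  for x :: "complex^('m1::finite + 'm2::finite)"
  unfolding power2_norm_eq_inner
  by (simp add: inner_vec_def sum_UNIV_Plus)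

lemma ctranspose_dirac_V [simp]: "(dirac_V w)\<^sup>\<dagger> = dirac_V w"
  by (auto simp: dirac_V_def ctranspose_def vcat_def hcat_def vec_eq_iff split: sum.split)

text \<open>The compressed matrix is automatically Hermitian, which leaves only the sign of its
  form. That is a condition on the range of \<open>P\<close>, hence stable under invertible right
  factors.\<close>

lemma pos_semidef_dirac_iff:
  "pos_semidef (P\<^sup>\<dagger> ** dirac_j ** P) \<longleftrightarrow> (\<forall>c. 0 \<le> (P *v c) \<bullet> (dirac_j *v (P *v c)))"
  by (simp add: pos_semidef_def Re_sesq_form inner_apply_left ctranspose_mult matrix_mul_assoc)

lemma pos_def_gram_iff: "pos_def (P\<^sup>\<dagger> ** P) \<longleftrightarrow> (\<forall>c. P *v c = 0 \<longrightarrow> c = 0)"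
proof -
  have "x \<bullet> (P\<^sup>\<dagger> *v (P *v x)) = (P *v x) \<bullet> (P *v x)" for x
    by (simp add: inner_apply_left)
  then show ?thesis
    unfolding pos_def_def Re_sesq_form mult_apply by (auto simp: ctranspose_mult)
qed

subsection \<open>Linear differential equations on the half-line\<close>

lemma at_within_halfline_cut: "0 \<le> x \<Longrightarrow> x < T \<Longrightarrow> at x within {0..T} = at x within {0..}"
  for x T :: real
  by (rule at_within_nhd[of _ "{..<T}"]) auto

text \<open>Mean value inequality for derivatives within the half-line. At interior points they are
  two-sided derivatives, so the usual bound on \<open>{0..b}\<close> applies once
  \<open>0 < b\<close>.\<close>

lemma halfline_derivative_bound:
  fixes f :: "real \<Rightarrow> 'a::real_normed_vector"
  assumes f: "\<And>x. 0 \<le> x \<Longrightarrow> x \<le> b \<Longrightarrow> (f has_vector_derivative f' x) (at x within {0..})"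
    and \<phi>: "\<And>x. 0 \<le> x \<Longrightarrow> x \<le> b \<Longrightarrow> (\<phi> has_vector_derivative \<phi>' x) (at x within {0..})"
    and le: "\<And>x. 0 \<le> x \<Longrightarrow> x \<le> b \<Longrightarrow> norm (f' x) \<le> \<phi>' x"
    and b: "0 \<le> b"
  shows "norm (f b - f 0) \<le> \<phi> b - \<phi> 0"
proof (cases "b = 0")
  case False
  have at: "at x within {0..} = at x" if "0 < x" for x :: real
    using that by (intro at_within_interior) (simp add: interior_real_atLeast)
  have "continuous_on {0..b} f" "continuous_on {0..b} \<phi>"
    unfolding continuous_on_eq_continuous_within
    using has_vector_derivative_continuous[OF has_vector_derivative_within_subset[OF f]]
      has_vector_derivative_continuous[OF has_vector_derivative_within_subset[OF \<phi>]]
    by simp_all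
  then show ?thesis
  proof (intro differentiable_bound_general[of 0 b f \<phi> f' \<phi>'])
    fix x assume "0 < x" "x < b"
    with f[of x] \<phi>[of x] at[of x] le[of x]
    show "(f has_vector_derivative f' x) (at x)" "(\<phi> has_vector_derivative \<phi>' x) (at x)"
        "norm (f' x) \<le> \<phi>' x"
      by simp_all
  qed (use False b in auto)
qed simp

lemma halfline_mono:
  fixes f :: "real \<Rightarrow> real"
  assumes "\<And>x. 0 \<le> x \<Longrightarrow> (f has_vector_derivative f' x) (at x within {0..})"
    and "\<And>x. 0 \<le> x \<Longrightarrow> 0 \<le> f' x" and "0 \<le> b"
  shows "f 0 \<le> f b"
  using halfline_derivative_bound[of b "\<lambda>_. 0 :: real" "\<lambda>_. 0" f f'] assms by simp

lemma halfline_constant: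
  fixes f :: "real \<Rightarrow> 'a::real_normed_vector"
  assumes "\<And>x. 0 \<le> x \<Longrightarrow> (f has_vector_derivative 0) (at x within {0..})" and "0 \<le> b"
  shows "f b = f 0"
  using halfline_derivative_bound[of b f "\<lambda>_. 0" "\<lambda>_. 0 :: real" "\<lambda>_. 0"] assms by simp

lemma halfline_integral_derivative:
  fixes f :: "real \<Rightarrow> 'a::banach"
  assumes "continuous_on {0..} f" "0 \<le> x"
  shows "((\<lambda>x. integral {0..x} f) has_vector_derivative f x) (at x within {0..})"
proof -
  have "continuous_on {0..x + 1} f"
    using assms by (auto intro: continuous_on_subset)
  from integral_has_vector_derivative[OF this, of x] show ?thesis
    using assms at_within_halfline_cut[of x "x + 1"] by simp
qed

text \<open>The \<open>p k\<close> are the terms of a Picard series. If multiplication by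
  \<open>A\<close> is bounded by \<open>M\<close> on a compact interval, induction bounds them by
  \<open>norm y * M ^ k * (t ^ k / fact k)\<close>. Comparison with the exponential series gives
  uniform convergence, and multiplication by \<open>A\<close> transfers it to the derivatives. A
  constant \<open>A\<close> later yields the matrix exponential, a variable one the fundamental
  solution.\<close>

lemma picard_series:
  fixes prod :: "'a::real_normed_vector \<Rightarrow> 'b::banach \<Rightarrow> 'b" and p :: "nat \<Rightarrow> real \<Rightarrow> 'b"
  assumes bil: "bounded_bilinear prod" and A: "continuous_on {0..} A"
    and p_0: "\<And>x. p 0 x = y"
    and p_Suc_0: "\<And>k. p (Suc k) 0 = 0"
    and p_Suc: "\<And>k x. 0 \<le> x \<Longrightarrow> (p (Suc k) has_vector_derivative prod (A x) (p k x)) (at x within {0..})"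
    and "0 \<le> x"
  shows "summable (\<lambda>k. p k x)"
    and "((\<lambda>x. \<Sum>k. p k x) has_vector_derivative prod (A x) (\<Sum>k. p k x)) (at x within {0..})"
proof -
  interpret bounded_bilinear prod by fact
  \<comment> \<open>The compact interval reaches beyond \<open>x\<close>, so that derivatives within
    it and within the half-line agree at \<open>x\<close>.\<close>
  define T where "T = x + 1"
  have T: "0 < T" "x < T" "x \<in> {0..T}" using \<open>0 \<le> x\<close> by (auto simp: T_def)
  obtain B where B: "\<And>t. t \<in> {0..T} \<Longrightarrow> norm (A t) \<le> B"
  proof -
    have "compact (A ` {0..T})"
      by (rule compact_continuous_image[OF continuous_on_subset[OF A]]) auto
    then have "bounded (A ` {0..T})" by (rule compact_imp_bounded)
    then show ?thesis using that unfolding bounded_iff by blast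
  qed
  obtain K where K: "0 \<le> K" "\<And>a b. norm (prod a b) \<le> norm a * norm b * K"
    using nonneg_bounded by blast
  define M where "M = B * K"
  have B0: "0 \<le> B" using order_trans[OF norm_ge_zero B[of 0]] T by simp
  have M0: "0 \<le> M" using B0 K by (simp add: M_def)
  have M: "norm (prod (A t) z) \<le> M * norm z" if "t \<in> {0..T}" for t z
  proof -
    have "norm (prod (A t) z) \<le> norm (A t) * norm z * K" by (rule K)
    also have "\<dots> \<le> B * norm z * K"
      using B[OF that] K by (intro mult_right_mono) auto
    finally show ?thesis by (simp add: M_def mult_ac)
  qed
  have bound: "norm (p k t) \<le> norm y * M ^ k * (t ^ k / fact k)" if "t \<in> {0..T}" for k t
    using that
  proof (induction k arbitrary: t)
    case 0
    then show ?case by (simp add: p_0)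
  next
    case (Suc k)
    have "norm (p (Suc k) t - p (Suc k) 0)
        \<le> norm y * M ^ Suc k * (t ^ Suc k / fact (Suc k)) - norm y * M ^ Suc k * (0 ^ Suc k / fact (Suc k))"
    proof (rule halfline_derivative_bound[OF p_Suc])
      fix s assume s: "0 \<le> s" "s \<le> t"
      have "((\<lambda>s. norm y * M ^ Suc k * (s ^ Suc k / fact (Suc k))) has_real_derivative
          norm y * M ^ Suc k * (real (Suc k) * s ^ k / fact (Suc k))) (at s within {0..})"
        using DERIV_pow[of "Suc k" s "{0..}"] by (intro DERIV_cmult DERIV_cdivide) simp
      also have "real (Suc k) * s ^ k / fact (Suc k) = s ^ k / fact k"
        by (simp add: field_simps del: of_nat_Suc)
      finally show "((\<lambda>s. norm y * M ^ Suc k * (s ^ Suc k / fact (Suc k))) has_vector_derivative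
          norm y * M ^ Suc k * (s ^ k / fact k)) (at s within {0..})"
        by (simp add: has_real_derivative_iff_has_vector_derivative)
      have sT: "s \<in> {0..T}" using s Suc.prems by simp
      have "norm (prod (A s) (p k s)) \<le> M * norm (p k s)" by (rule M[OF sT])
      also have "\<dots> \<le> M * (norm y * M ^ k * (s ^ k / fact k))"
        by (intro mult_left_mono Suc.IH sT M0)
      finally show "norm (prod (A s) (p k s)) \<le> norm y * M ^ Suc k * (s ^ k / fact k)"
        by (simp add: mult_ac)
    qed (use Suc.prems in auto)
    then show ?case by (simp add: p_Suc_0)
  qed
  have bound_T: "norm (p k t) \<le> norm y * (inverse (fact k) * (M * T) ^ k)" if "t \<in> {0..T}" for k t
  proof -
    have "norm y * M ^ k * (t ^ k / fact k) \<le> norm y * M ^ k * (T ^ k / fact k)"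
      using that M0 by (intro mult_left_mono divide_right_mono power_mono) auto
    also have "\<dots> = norm y * (inverse (fact k) * (M * T) ^ k)"
      by (simp add: power_mult_distrib divide_inverse)
    finally show ?thesis using bound[OF that, of k] by simp
  qed
  have sm: "summable (\<lambda>k. norm y * (inverse (fact k) * (M * T) ^ k))"
    by (intro summable_mult summable_exp)
  have smp: "summable (\<lambda>k. p k t)" if "t \<in> {0..T}" for t
    using summable_comparison_test'[OF sm, of 0 "\<lambda>k. p k t"] bound_T[OF that] by auto
  then show "summable (\<lambda>k. p k x)" using T by blast
  have ul: "uniform_limit {0..T} (\<lambda>n t. \<Sum>k<n. p k t) (\<lambda>t. \<Sum>k. p k t) sequentially"
    by (rule Weierstrass_m_test[OF bound_T sm])
  \<comment> \<open>The derivative of \<open>p k\<close>: zero for the constant term, and otherwise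
    built from the preceding term.\<close>
  define q where "q k t = (case k of 0 \<Rightarrow> 0 | Suc k \<Rightarrow> prod (A t) (p k t))" for k t
  have q: "(p k has_derivative (\<lambda>h. h *\<^sub>R q k t)) (at t within {0..T})" if "t \<in> {0..T}" for k t
  proof -
    have "(p k has_vector_derivative q k t) (at t within {0..})"
    proof (cases k)
      case 0
      have "p 0 = (\<lambda>x. y)" by (simp add: p_0 fun_eq_iff)
      then show ?thesis using 0 by (simp add: q_def)
    next
      case (Suc n)
      then show ?thesis using p_Suc[of t n] that by (simp add: q_def)
    qed
    from has_vector_derivative_within_subset[OF this, of "{0..T}"] show ?thesis
      by (simp add: has_vector_derivative_def)
  qed
  have "\<exists>g. \<forall>t\<in>{0..T}. (\<lambda>n. p n t) sums g t \<and>
      (g has_derivative (\<lambda>h. h *\<^sub>R prod (A t) (\<Sum>k. p k t))) (at t within {0..T})"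
  proof (rule has_derivative_series[where f' = "\<lambda>k t h. h *\<^sub>R q k t" and x = x])
    fix e :: real assume "0 < e"
    \<comment> \<open>The divisor is \<open>M + 1\<close> because \<open>M\<close> may be 0.\<close>
    then have "0 < e / (M + 1)" using M0 by simp
    with ul obtain N where N: "\<And>n t. n \<ge> N \<Longrightarrow> t \<in> {0..T} \<Longrightarrow>
        dist (\<Sum>k<n. p k t) (\<Sum>k. p k t) < e / (M + 1)"
      unfolding uniform_limit_iff eventually_sequentially by blast
    show "\<forall>\<^sub>F n in sequentially. \<forall>t\<in>{0..T}. \<forall>h.
        norm ((\<Sum>i<n. h *\<^sub>R q i t) - h *\<^sub>R prod (A t) (\<Sum>k. p k t)) \<le> e * norm h"
      unfolding eventually_sequentially
    \<comment> \<open>The first \<open>n\<close> derivatives involve only the first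
      \<open>n - 1\<close> terms of the series, so the threshold moves by one.\<close>
    proof (intro exI[of _ "Suc N"] allI impI ballI)
      fix n t and h :: real assume "Suc N \<le> n" and t: "t \<in> {0..T}"
      then obtain m where m: "n = Suc m" "N \<le> m" by (cases n) auto
      have "(\<Sum>i<n. q i t) = prod (A t) (\<Sum>k<m. p k t)"
        by (simp add: m(1) sum.lessThan_Suc_shift q_def sum_right del: sum.lessThan_Suc)
      then have "norm ((\<Sum>i<n. q i t) - prod (A t) (\<Sum>k. p k t)) \<le>
          M * norm ((\<Sum>k<m. p k t) - (\<Sum>k. p k t))"
        using M[OF t] by (simp flip: diff_right)
      also have "\<dots> \<le> M * (e / (M + 1))"
        using N[OF m(2) t] M0 by (intro mult_left_mono) (auto simp: dist_norm)
      also have "\<dots> \<le> e" using M0 \<open>0 < e\<close> by (simp add: field_simps)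
      finally have "norm ((\<Sum>i<n. q i t) - prod (A t) (\<Sum>k. p k t)) \<le> e" .
      then have "norm h * norm ((\<Sum>i<n. q i t) - prod (A t) (\<Sum>k. p k t)) \<le> norm h * e"
        by (intro mult_left_mono) auto
      then show "norm ((\<Sum>i<n. h *\<^sub>R q i t) - h *\<^sub>R prod (A t) (\<Sum>k. p k t)) \<le> e * norm h"
        by (simp add: mult.commute flip: scaleR_sum_right scaleR_diff_right)
    qed
  next
    show "(\<lambda>n. p n x) sums (\<Sum>n. p n x)" by (rule summable_sums[OF smp[OF T(3)]])
  qed (rule convex_real_interval q T | assumption)+
  then obtain g where g: "\<And>t. t \<in> {0..T} \<Longrightarrow> (\<lambda>n. p n t) sums g t"
      "(g has_vector_derivative prod (A x) (\<Sum>k. p k x)) (at x within {0..T})"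
    using T(3) unfolding has_vector_derivative_def by blast
  have "((\<lambda>x. \<Sum>k. p k x) has_vector_derivative prod (A x) (\<Sum>k. p k x)) (at x within {0..T})"
    by (rule has_vector_derivative_transform[OF T(3) _ g(2)]) (simp add: sums_unique[OF g(1)])
  then show "((\<lambda>x. \<Sum>k. p k x) has_vector_derivative prod (A x) (\<Sum>k. p k x)) (at x within {0..})"
    using at_within_halfline_cut[of x T] T by simp
qed

text \<open>Iterating the Volterra integral operator on the constant \<open>y\<close> produces the
  terms for \<open>picard_series\<close>. All but the constant one vanish at the origin, which gives
  the initial value.\<close>

lemma linear_ode_solution_exists:
  fixes prod :: "'a::real_normed_vector \<Rightarrow> 'b::banach \<Rightarrow> 'b"
  assumes bil: "bounded_bilinear prod" and A: "continuous_on {0..} A"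
  shows "\<exists>Y. Y 0 = y \<and> (\<forall>x\<ge>0. (Y has_vector_derivative prod (A x) (Y x)) (at x within {0..}))"
proof -
  interpret bounded_bilinear prod by fact
  define p where "p = rec_nat (\<lambda>x. y) (\<lambda>k f x. integral {0..x} (\<lambda>t. prod (A t) (f t)))"
  have p_0: "p 0 = (\<lambda>x. y)" and p_Suc: "p (Suc k) = (\<lambda>x. integral {0..x} (\<lambda>t. prod (A t) (p k t)))" for k
    by (simp_all add: p_def)
  have cont: "continuous_on {0..} (p k)" for k
  proof (induction k)
    case 0
    show ?case unfolding p_0 by (rule continuous_on_const)
  next
    case (Suc k)
    show ?case
      unfolding p_Suc continuous_on_eq_continuous_within
    proof
      fix x :: real assume "x \<in> {0..}"
      then have "0 \<le> x" by simp
      from has_vector_derivative_continuous[OF halfline_integral_derivative[OF continuous_on[OF A Suc] this]]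
      show "continuous (at x within {0..}) (\<lambda>x. integral {0..x} (\<lambda>t. prod (A t) (p k t)))" .
    qed
  qed
  have deriv: "(p (Suc k) has_vector_derivative prod (A x) (p k x)) (at x within {0..})"
    if "0 \<le> x" for k x
    unfolding p_Suc by (rule halfline_integral_derivative[OF continuous_on[OF A cont] that])
  have "p (Suc k) 0 = 0" for k by (simp add: p_Suc)
  note series = picard_series[of prod A p y, OF bil A fun_cong[OF p_0] this deriv]
  have "(\<Sum>k. p k 0) = y"
  proof -
    have "p k 0 = 0" if "k \<notin> {0}" for k
      using that by (cases k) (simp_all add: p_Suc)
    then have "(\<lambda>k. p k 0) sums (\<Sum>k\<in>{0}. p k 0)"
      by (intro sums_finite) auto
    then have "(\<Sum>k. p k 0) = (\<Sum>k\<in>{0}. p k 0)" by (rule sums_unique[symmetric])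
    then show ?thesis by (simp add: p_0)
  qed
  then show ?thesis using series(2) by (intro exI[of _ "\<lambda>x. \<Sum>k. p k x"]) auto
qed

subsection \<open>Derivatives of the matrix inverse and the matrix exponential\<close>

text \<open>With \<open>B = matrix_inv A\<close>, the identity \<open>eq\<close> gives
  \<open>norm (matrix_inv M - B) \<le> d M * norm (matrix_inv M)\<close>. Once
  \<open>d M < 1 / 2\<close>, half of \<open>norm (matrix_inv M)\<close> can be absorbed, which
  bounds it by \<open>2 * norm B\<close>.\<close>

lemma tendsto_matrix_inv:
  fixes F :: "'a \<Rightarrow> complex^'p^'p"
  assumes F: "(F \<longlongrightarrow> A) net" and A: "invertible A"
    and ev: "eventually (\<lambda>t. invertible (F t)) net"
  shows "((\<lambda>t. matrix_inv (F t)) \<longlongrightarrow> matrix_inv A) net"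
proof -
  interpret mm: bounded_bilinear "(**) :: complex^'p^'p \<Rightarrow> complex^'p^'p \<Rightarrow> _"
    by (rule bounded_bilinear_matrix_mult)
  define B where "B = matrix_inv A"
  have eq: "matrix_inv M - B = - (B ** (M - A) ** matrix_inv M)" if "invertible M" for M
    using A that by (intro matrix_eqI) (simp add: B_def matrix_inv_apply algebra_simps)
  obtain K where K: "0 < K" "\<And>(X :: complex^'p^'p) (Y :: complex^'p^'p). norm (X ** Y) \<le> norm X * norm Y * K"
    using mm.pos_bounded by blast
  define d where "d M = norm (B ** (M - A)) * K" for M
  have D: "((\<lambda>t. d (F t)) \<longlongrightarrow> 0) net"
  proof -
    have "((\<lambda>t. norm (B ** (F t - A)) * K) \<longlongrightarrow> norm (B ** (A - A)) * K) net"
      by (intro tendsto_intros mm.tendsto F)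
    then show ?thesis by (simp add: d_def mm.zero_right)
  qed
  have le: "norm (matrix_inv M - B) \<le> 2 * norm B * d M" if M: "invertible M" "d M < 1 / 2" for M
  proof -
    have 1: "norm (matrix_inv M - B) \<le> d M * norm (matrix_inv M)"
      unfolding eq[OF M(1)] d_def norm_minus_cancel
      using K(2)[of "B ** (M - A)" "matrix_inv M"] by (simp add: mult_ac)
    have "0 \<le> d M" using K(1) by (simp add: d_def)
    have "norm (matrix_inv M) \<le> norm B + norm (matrix_inv M - B)"
      using norm_triangle_ineq[of B "matrix_inv M - B"] by simp
    also have "\<dots> \<le> norm B + norm (matrix_inv M) / 2"
      using 1 mult_right_mono[of "d M" "1 / 2" "norm (matrix_inv M)"] M(2) by simp
    finally have "norm (matrix_inv M) \<le> 2 * norm B" by simp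
    from mult_left_mono[OF this \<open>0 \<le> d M\<close>] 1 show ?thesis by (simp add: mult_ac)
  qed
  have "eventually (\<lambda>t. d (F t) < 1 / 2) net"
    using order_tendstoD(2)[OF D, of "1 / 2"] by simp
  with ev have "eventually (\<lambda>t. norm (matrix_inv (F t) - B) \<le> 2 * norm B * d (F t)) net"
    by eventually_elim (rule le)
  moreover have "((\<lambda>t. 2 * norm B * d (F t)) \<longlongrightarrow> 0) net"
    using tendsto_mult_left[OF D, of "2 * norm B"] by simp
  ultimately have "((\<lambda>t. matrix_inv (F t) - B) \<longlongrightarrow> 0) net"
    by (rule Lim_null_comparison)
  then show ?thesis by (simp add: LIM_zero_iff B_def)
qed

text \<open>Rests on \<open>G t - G x = - (B ** (F t - F x) ** G t)\<close>: differentiability of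
  \<open>F\<close> and continuity of its inverse \<open>G\<close> then suffice.\<close>

lemma has_vector_derivative_matrix_inv:
  fixes F :: "real \<Rightarrow> complex^'p^'p"
  assumes F: "(F has_vector_derivative F') (at x within S)"
    and inv: "\<And>t. t \<in> S \<Longrightarrow> invertible (F t)" and "x \<in> S"
  shows "((\<lambda>t. matrix_inv (F t)) has_vector_derivative
    - (matrix_inv (F x) ** F' ** matrix_inv (F x))) (at x within S)"
proof -
  interpret mm: bounded_bilinear "(**) :: complex^'p^'p \<Rightarrow> complex^'p^'p \<Rightarrow> _"
    by (rule bounded_bilinear_matrix_mult)
  define B where "B = matrix_inv (F x)"
  define G where "G t = matrix_inv (F t)" for t
  have evS: "eventually (\<lambda>t. t \<in> S) (at x within S)"
    by (simp add: eventually_at_topological) blast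
  have "continuous (at x within S) F" by (rule has_vector_derivative_continuous[OF F])
  then have G: "(G \<longlongrightarrow> B) (at x within S)"
    unfolding G_def B_def continuous_within
    by (rule tendsto_matrix_inv) (use inv \<open>x \<in> S\<close> evS in \<open>auto elim!: eventually_mono\<close>)
  define r where "r t = ((F t - F x) - (t - x) *\<^sub>R F') /\<^sub>R norm (t - x)" for t
  have r: "(r \<longlongrightarrow> 0) (at x within S)"
    using F unfolding r_def has_vector_derivative_def has_derivative_at_within by blast
  \<comment> \<open>Here \<open>r\<close> is the normalized remainder for \<open>F\<close>. The
    second term is the error of replacing \<open>G t\<close> by \<open>B\<close>; its factor
    \<open>sgn (t - x)\<close> is bounded.\<close>
  have eq: "(G t - G x - (t - x) *\<^sub>R - (B ** F' ** B)) /\<^sub>R norm (t - x) =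
      - (B ** r t ** G t) - sgn (t - x) *\<^sub>R (B ** F' ** (G t - B))" if "t \<in> S" for t
  proof -
    have 1: "G t - G x = - (B ** (F t - F x) ** G t)"
      using inv[OF that] inv[OF \<open>x \<in> S\<close>]
      by (intro matrix_eqI) (simp add: G_def B_def matrix_inv_apply algebra_simps)
    have 2: "sgn (t - x) = (t - x) / norm (t - x)" by (simp add: real_sgn_eq)
    show ?thesis
      unfolding 1 2 r_def
      by (simp add: mm.diff_left mm.diff_right mm.add_left mm.add_right mm.scaleR_left
          mm.scaleR_right algebra_simps divide_inverse)
  qed
  have "((\<lambda>t. - (B ** r t ** G t) - sgn (t - x) *\<^sub>R (B ** F' ** (G t - B))) \<longlongrightarrow> 0) (at x within S)"
  proof -
    have "((\<lambda>t. - (B ** r t ** G t)) \<longlongrightarrow> - (B ** 0 ** B)) (at x within S)"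
      by (intro tendsto_intros mm.tendsto r G)
    moreover have "((\<lambda>t. B ** F' ** (G t - B)) \<longlongrightarrow> B ** F' ** (B - B)) (at x within S)"
      by (intro tendsto_intros mm.tendsto G)
    then have "((\<lambda>t. norm (B ** F' ** (G t - B))) \<longlongrightarrow> 0) (at x within S)"
      using tendsto_norm_zero by (simp add: mm.zero_right)
    then have "((\<lambda>t. sgn (t - x) *\<^sub>R (B ** F' ** (G t - B))) \<longlongrightarrow> 0) (at x within S)"
      by (rule Lim_null_comparison[rotated]) (auto simp: abs_sgn_eq)
    ultimately have "((\<lambda>t. - (B ** r t ** G t) - sgn (t - x) *\<^sub>R (B ** F' ** (G t - B))) \<longlongrightarrow>
        - (B ** 0 ** B) - 0) (at x within S)"
      by (rule tendsto_diff)
    then show ?thesis by (simp add: mm.zero_left mm.zero_right)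
  qed
  moreover have "eventually (\<lambda>t. - (B ** r t ** G t) - sgn (t - x) *\<^sub>R (B ** F' ** (G t - B)) =
      (G t - G x - (t - x) *\<^sub>R - (B ** F' ** B)) /\<^sub>R norm (t - x)) (at x within S)"
    using evS by eventually_elim (rule eq[symmetric])
  ultimately have "((\<lambda>t. (G t - G x - (t - x) *\<^sub>R - (B ** F' ** B)) /\<^sub>R norm (t - x)) \<longlongrightarrow> 0)
      (at x within S)"
    by (rule Lim_transform_eventually)
  then show ?thesis
    unfolding G_def B_def has_vector_derivative_def has_derivative_at_within
    by (intro conjI bounded_linear_scaleR_left)
qed

section \<open>The matrix exponential\<close>

lemma mat_pow_scaleR: "mat_pow (r *\<^sub>R A) k = r ^ k *\<^sub>R mat_pow A k"
  by (induction k) (simp_all add: bounded_bilinear.scaleR_left[OF bounded_bilinear_matrix_mult]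
      bounded_bilinear.scaleR_right[OF bounded_bilinear_matrix_mult] mult.commute)

text \<open>Separates the real variable from the complex coefficient, so that the exponential need
  only be differentiated along \<open>x *\<^sub>R A\<close>.\<close>

lemma cscale_of_real: "cscale (c * of_real x) A = x *\<^sub>R cscale c A"
  by (simp add: cscale_def vec_eq_iff scaleR_conv_of_real[where 'a = complex] mult_ac)

text \<open>For the constant coefficient \<open>A\<close>, the exponential series is itself a Picard
  series starting from the identity matrix.\<close>

lemma mat_exp_series:
  fixes A :: "complex^'p^'p"
  assumes "0 \<le> x"
  shows "summable (\<lambda>k. mat_pow (x *\<^sub>R A) k /\<^sub>R fact k)"
    and "((\<lambda>x. mat_exp (x *\<^sub>R A)) has_vector_derivative A ** mat_exp (x *\<^sub>R A)) (at x within {0..})"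
proof -
  interpret mm: bounded_bilinear "(**) :: complex^'p^'p \<Rightarrow> complex^'p^'p \<Rightarrow> _"
    by (rule bounded_bilinear_matrix_mult)
  define p where "p k x = (x ^ k / fact k) *\<^sub>R mat_pow A k" for k :: nat and x :: real
  have p: "mat_pow (x *\<^sub>R A) k /\<^sub>R fact k = p k x" for k x
    by (simp add: p_def mat_pow_scaleR divide_inverse mult.commute)
  have deriv: "(p (Suc k) has_vector_derivative A ** p k x) (at x within {0..})" for k x
  proof -
    have "((\<lambda>x. x ^ Suc k / fact (Suc k)) has_real_derivative real (Suc k) * x ^ k / fact (Suc k))
        (at x within {0..})"
      using DERIV_pow[of "Suc k" x "{0..}"] by (intro DERIV_cdivide) simp
    also have "real (Suc k) * x ^ k / fact (Suc k) = x ^ k / fact k"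
      by (simp add: field_simps del: of_nat_Suc)
    finally have "((\<lambda>x. (x ^ Suc k / fact (Suc k)) *\<^sub>R mat_pow A (Suc k)) has_vector_derivative
        (x ^ k / fact k) *\<^sub>R mat_pow A (Suc k)) (at x within {0..})"
      using has_vector_derivative_scaleR[OF _ has_vector_derivative_const] by fastforce
    moreover have "p (Suc k) = (\<lambda>x. (x ^ Suc k / fact (Suc k)) *\<^sub>R mat_pow A (Suc k))"
      by (intro ext) (simp only: p_def)
    moreover have "A ** p k x = (x ^ k / fact k) *\<^sub>R mat_pow A (Suc k)"
      by (simp add: p_def mm.scaleR_right)
    ultimately show ?thesis by (simp only:)
  qed
  have "p 0 x = mat 1" "p (Suc k) 0 = 0" for k x by (simp_all add: p_def)
  note series = picard_series[of "(**)" "\<lambda>_. A" p, OF bounded_bilinear_matrix_mult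
      continuous_on_const this deriv assms]
  show "summable (\<lambda>k. mat_pow (x *\<^sub>R A) k /\<^sub>R fact k)"
    unfolding p by (rule series)
  show "((\<lambda>x. mat_exp (x *\<^sub>R A)) has_vector_derivative A ** mat_exp (x *\<^sub>R A)) (at x within {0..})"
    unfolding mat_exp_def p by (rule series)
qed

lemma summable_mat_exp: "summable (\<lambda>k. mat_pow A k /\<^sub>R fact k)"
  using mat_exp_series(1)[of 1 A] by simp

lemma has_vector_derivative_mat_exp:
  "0 \<le> x \<Longrightarrow> ((\<lambda>x. mat_exp (cscale (c * of_real x) A)) has_vector_derivative
     cscale c A ** mat_exp (cscale (c * of_real x) A)) (at x within {0..})"
  unfolding cscale_of_real by (rule mat_exp_series(2))

lemma mat_exp_0 [simp]: "mat_exp 0 = (mat 1 :: complex^'p^'p)"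
proof -
  have "mat_pow (0 :: complex^'p^'p) k /\<^sub>R fact k = (if k = 0 then mat 1 else 0)" for k
    by (cases k) (simp_all add: matrix_matrix_mult_def vec_eq_iff)
  then show ?thesis
    unfolding mat_exp_def
    using sums_unique[OF sums_If_finite_set[of "{0}" "\<lambda>_. mat 1 :: complex^'p^'p"]]
    by (simp cong: if_cong)
qed

lemma mat_exp_commute:
  fixes A B :: "complex^'p^'p"
  assumes "B ** A = A ** B"
  shows "B ** mat_exp A = mat_exp A ** B"
proof -
  interpret mm: bounded_bilinear "(**) :: complex^'p^'p \<Rightarrow> complex^'p^'p \<Rightarrow> _"
    by (rule bounded_bilinear_matrix_mult)
  have "B ** mat_pow A k = mat_pow A k ** B" for k
    by (induction k) (use assms in \<open>simp_all, metis matrix_mul_assoc\<close>)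
  then show ?thesis
    unfolding mat_exp_def
    by (simp add: bounded_linear.suminf[OF mm.bounded_linear_right summable_mat_exp]
        bounded_linear.suminf[OF mm.bounded_linear_left summable_mat_exp]
        mm.scaleR_left mm.scaleR_right)
qed

lemma ctranspose_mat_exp: "(mat_exp A)\<^sup>\<dagger> = mat_exp (A\<^sup>\<dagger>)"
proof -
  have comm: "A\<^sup>\<dagger> ** mat_pow (A\<^sup>\<dagger>) k = mat_pow (A\<^sup>\<dagger>) k ** A\<^sup>\<dagger>" for k
    by (induction k) (simp_all, metis matrix_mul_assoc)
  have "(mat_pow A k)\<^sup>\<dagger> = mat_pow (A\<^sup>\<dagger>) k" for k
    by (induction k) (simp_all add: ctranspose_mult comm)
  then show ?thesis
    unfolding mat_exp_def
    by (simp add: bounded_linear.suminf[OF bounded_linear_ctranspose summable_mat_exp]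
        linear_scale[OF bounded_linear.linear[OF bounded_linear_ctranspose]])
qed

subsection \<open>Solutions of a Dirac system and the Weyl sets\<close>

text \<open>Vector form of the system at one spectral parameter, with the right-hand side expanded.
  Columns of the fundamental solution and the explicit solution are compared through it.\<close>

definition dirac_solution ::
    "(real \<Rightarrow> complex^'m2^'m1) \<Rightarrow> complex \<Rightarrow> (real \<Rightarrow> complex^('m1 + 'm2)) \<Rightarrow> bool" where
  "dirac_solution v z y \<longleftrightarrow> (\<forall>x\<ge>0. (y has_vector_derivative
     (\<i> * z) *s (dirac_j *v y x) + \<i> *s (dirac_j *v (dirac_V (v x) *v y x))) (at x within {0..}))"

abbreviation dirac_q :: "complex^('m1::finite + 'm2::finite) \<Rightarrow> real" where
  "dirac_q y \<equiv> y \<bullet> (dirac_j *v y)"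

lemma dirac_solution_diff:
  assumes "dirac_solution v z y1" "dirac_solution v z y2"
  shows "dirac_solution v z (\<lambda>x. y1 x - y2 x)"
  unfolding dirac_solution_def
proof (intro allI impI)
  fix x :: real assume "0 \<le> x"
  with assms have "((\<lambda>x. y1 x - y2 x) has_vector_derivative
      ((\<i> * z) *s (dirac_j *v y1 x) + \<i> *s (dirac_j *v (dirac_V (v x) *v y1 x))) -
      ((\<i> * z) *s (dirac_j *v y2 x) + \<i> *s (dirac_j *v (dirac_V (v x) *v y2 x)))) (at x within {0..})"
    unfolding dirac_solution_def by (intro has_vector_derivative_diff) auto
  then show "((\<lambda>x. y1 x - y2 x) has_vector_derivative (\<i> * z) *s (dirac_j *v (y1 x - y2 x)) +
      \<i> *s (dirac_j *v (dirac_V (v x) *v (y1 x - y2 x)))) (at x within {0..})"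
    by (simp add: matrix_vector_mult_diff_distrib vec.scale_right_diff_distrib algebra_simps)
qed

text \<open>The matrix \<open>dirac_j\<close> squares to the identity and
  \<open>dirac_V (v x)\<close> is Hermitian, so the two potential terms are opposite and only the
  spectral parameters remain.\<close>

lemma dirac_wronskian_derivative:
  assumes y: "dirac_solution v z y" and w: "dirac_solution v \<zeta> w" and "0 \<le> x"
  shows "((\<lambda>x. w x \<bullet> (dirac_j *v y x)) has_vector_derivative
    w x \<bullet> ((\<i> * (z - cnj \<zeta>)) *s y x)) (at x within {0..})"
proof -
  define y' where "y' = (\<i> * z) *s (dirac_j *v y x) + \<i> *s (dirac_j *v (dirac_V (v x) *v y x))"
  define w' where "w' = (\<i> * \<zeta>) *s (dirac_j *v w x) + \<i> *s (dirac_j *v (dirac_V (v x) *v w x))"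
  have y': "(y has_vector_derivative y') (at x within {0..})"
    and w': "(w has_vector_derivative w') (at x within {0..})"
    using y w \<open>0 \<le> x\<close> unfolding dirac_solution_def y'_def w'_def by auto
  have "((\<lambda>x. dirac_j *v y x) has_vector_derivative dirac_j *v y') (at x within {0..})"
    by (rule bounded_linear.has_vector_derivative[OF
          bounded_bilinear.bounded_linear_right[OF bounded_bilinear_matrix_apply] y'])
  from bounded_bilinear.has_vector_derivative[OF bounded_bilinear_inner w' this]
  have "((\<lambda>x. w x \<bullet> (dirac_j *v y x)) has_vector_derivative
    w x \<bullet> (dirac_j *v y') + w' \<bullet> (dirac_j *v y x)) (at x within {0..})" .
  moreover have "w' \<bullet> (dirac_j *v y x) =
      w x \<bullet> ((- \<i> * cnj \<zeta>) *s y x) - w x \<bullet> (\<i> *s (dirac_V (v x) *v y x))"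
  proof -
    have "w' \<bullet> (dirac_j *v y x) = ((\<i> * \<zeta>) *s w x + \<i> *s (dirac_V (v x) *v w x)) \<bullet> y x"
      by (simp add: w'_def matrix_vector_right_distrib flip: inner_dirac_j(2))
    also have "\<dots> = w x \<bullet> ((- \<i> * cnj \<zeta>) *s y x) - w x \<bullet> (\<i> *s (dirac_V (v x) *v y x))"
      by (simp add: inner_add_left inner_cscale_left inner_apply_left)
    finally show ?thesis .
  qed
  moreover have "w x \<bullet> (dirac_j *v y') =
      w x \<bullet> ((\<i> * z) *s y x) + w x \<bullet> (\<i> *s (dirac_V (v x) *v y x))"
    by (simp add: y'_def matrix_vector_right_distrib inner_add_right)
  ultimately show ?thesis
    by (simp add: vec.scale_left_distrib vec.scale_left_diff_distrib inner_diff_right algebra_simps)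
qed

text \<open>The case \<open>\<zeta> = z\<close>, \<open>w = y\<close> of the Wronskian, where
  \<open>\<i> * (z - cnj z)\<close> is the real number \<open>- 2 * Im z\<close>.\<close>

lemma dirac_q_derivative:
  assumes "dirac_solution v z y" "0 \<le> x"
  shows "((\<lambda>x. dirac_q (y x)) has_vector_derivative - 2 * Im z * (norm (y x))\<^sup>2) (at x within {0..})"
proof -
  have "\<i> * (z - cnj z) = of_real (- 2 * Im z)" by (simp add: complex_eq_iff)
  with dirac_wronskian_derivative[OF assms(1,1,2)] show ?thesis
    unfolding power2_norm_eq_inner by (simp only: cscale_real inner_scaleR_right)
qed

lemma dirac_q_decreasing:
  assumes "dirac_solution v z y" "0 \<le> x" "0 \<le> Im z"
  shows "dirac_q (y x) \<le> dirac_q (y 0)"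
proof -
  have "- dirac_q (y 0) \<le> - dirac_q (y x)"
    by (rule halfline_mono[OF has_vector_derivative_minus[OF dirac_q_derivative[OF assms(1)]]])
       (use assms in auto)
  then show ?thesis by simp
qed

section \<open>Fundamental solution, uniqueness and Weyl sets\<close>

context
  fixes v :: "real \<Rightarrow> complex^'m2^'m1" and u
  assumes fund: "dirac_fundamental_solution v u"
begin

lemma fundamental_0 [simp]: "u 0 z = mat 1"
  using fund by (simp add: dirac_fundamental_solution_def)

lemma fundamental_apply_solution: "dirac_solution v z (\<lambda>x. u x z *v h)"
  unfolding dirac_solution_def
proof (intro allI impI)
  fix x :: real assume "0 \<le> x"
  with fund have "((\<lambda>x. u x z) has_vector_derivative
      cscale \<i> (cscale z dirac_j + dirac_j ** dirac_V (v x)) ** u x z) (at x within {0..})"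
    by (simp add: dirac_fundamental_solution_def)
  from bounded_linear.has_vector_derivative[OF
      bounded_bilinear.bounded_linear_left[OF bounded_bilinear_matrix_apply] this, of h]
  show "((\<lambda>x. u x z *v h) has_vector_derivative (\<i> * z) *s (dirac_j *v (u x z *v h)) +
      \<i> *s (dirac_j *v (dirac_V (v x) *v (u x z *v h)))) (at x within {0..})"
    by (simp add: matrix_vector_mult_add_rdistrib vec.scale_right_distrib)
qed

text \<open>Pairing with the conjugate parameter makes the factor \<open>z - cnj \<zeta>\<close>
  vanish, so the Wronskian is constant.\<close>

lemma fundamental_wronskian:
  assumes "dirac_solution v z y" "0 \<le> x"
  shows "(u x (cnj z) *v a) \<bullet> (dirac_j *v y x) = a \<bullet> (dirac_j *v y 0)"
  using halfline_constant[of "\<lambda>x. (u x (cnj z) *v a) \<bullet> (dirac_j *v y x)" x]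
    dirac_wronskian_derivative[OF assms(1) fundamental_apply_solution[of "cnj z" a]] assms(2)
  by simp

text \<open>A kernel vector \<open>b\<close> makes the constant Wronskian zero for every
  \<open>a\<close>; the choice \<open>a = dirac_j *v b\<close> turns its value at the origin into
  the squared norm of \<open>b\<close>.\<close>

lemma fundamental_invertible:
  assumes "0 \<le> x"
  shows "invertible (u x z)"
proof (rule invertible_if_ker_trivial)
  fix b assume "u x z *v b = 0"
  then have "(dirac_j *v b) \<bullet> (dirac_j *v b) = 0"
    using fundamental_wronskian[OF fundamental_apply_solution assms, of z "dirac_j *v b" b] by simp
  then show "b = 0" by (simp add: inner_dirac_j)
qed

text \<open>The difference of the two solutions starts at zero, so its Wronskian with every solution
  at \<open>cnj z\<close> vanishes. Invertibility of \<open>u x (cnj z)\<close> allows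
  \<open>a\<close> to be chosen so that the Wronskian at \<open>x\<close> is the squared norm of the
  difference \<open>d\<close>.\<close>

lemma dirac_solution_eq_fundamental:
  assumes "dirac_solution v z y" "0 \<le> x"
  shows "y x = u x z *v y 0"
proof -
  define d where "d = y x - u x z *v y 0"
  define a where "a = matrix_inv (u x (cnj z)) *v (dirac_j *v d)"
  have "(u x (cnj z) *v a) \<bullet> (dirac_j *v d) = 0"
    using fundamental_wronskian[OF dirac_solution_diff[OF assms(1) fundamental_apply_solution], of x a "y 0"]
      assms(2) by (simp add: d_def)
  then have "(dirac_j *v d) \<bullet> (dirac_j *v d) = 0"
    using matrix_inv_apply(1)[OF fundamental_invertible[OF assms(2)]] by (simp add: a_def)
  then have "d = 0" by (simp add: inner_dirac_j)
  then show ?thesis by (simp add: d_def)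
qed

text \<open>Up to an invertible right factor, an admissible \<open>P z\<close> equals
  \<open>u x z ** vcat (mat 1) \<phi>\<close>, so property-j becomes a condition on
  \<open>\<phi>\<close>. Conversely this product, taken as a constant function, is
  admissible.\<close>

lemma weyl_set_eq:
  assumes x: "0 \<le> x" and z: "0 \<le> Im z"
  shows "weyl_set u x z = {\<phi>. \<forall>c. 0 \<le> dirac_q (u x z *v (vcat (mat 1) \<phi> *v c))}"
proof (intro equalityI subsetI)
  note uinv = fundamental_invertible[OF x, of z]
  fix \<phi> assume "\<phi> \<in> weyl_set u x z"
  then obtain P where \<phi>: "\<phi> = weyl_transform u x z P" and "nonsingular_j_at (P z)"
    unfolding weyl_set_def non_exceptional_def by blast
  then have P: "\<And>c. P z *v c = 0 \<Longrightarrow> c = 0" "\<And>c. 0 \<le> dirac_q (P z *v c)"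
    unfolding nonsingular_j_at_def pos_def_gram_iff pos_semidef_dirac_iff by blast+
  define Q where "Q = matrix_inv (u x z) ** P z"
  have uQ: "u x z *v (Q *v c) = P z *v c" for c
    using matrix_inv_apply(1)[OF uinv] by (simp add: Q_def)
  \<comment> \<open>The form decreases along solutions, so nonnegativity at \<open>x\<close> carries
    back to the origin.\<close>
  have Q: "0 \<le> dirac_q (Q *v c)" for c
    using dirac_q_decreasing[OF fundamental_apply_solution x z, of "Q *v c"] P(2)[of c] uQ[of c] by simp
  define Q1 where "Q1 = hcat (mat 1) 0 ** Q"
  define Q2 where "Q2 = hcat 0 (mat 1) ** Q"
  have Q1: "Q1 *v c = (\<chi> a. (Q *v c) $ Inl a)" and Q2: "Q2 *v c = (\<chi> b. (Q *v c) $ Inr b)" for c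
    by (simp_all add: Q1_def Q2_def hcat_apply)
  \<comment> \<open>If the first block of a j-nonnegative vector is zero, so is the second. This
    provides the inverse in the linear fractional transform.\<close>
  have "invertible Q1"
  proof (rule invertible_if_ker_trivial)
    fix c assume "Q1 *v c = 0"
    with Q[of c] have "Q *v c = 0"
      using norm_block[of "Q *v c"] by (simp add: dirac_form Q1)
    then have "P z *v c = 0" using uQ[of c] by simp
    then show "c = 0" by (rule P)
  qed
  have \<phi>': "\<phi> = Q2 ** matrix_inv Q1"
    by (simp add: \<phi> weyl_transform_def Q1_def Q2_def Q_def matrix_mul_assoc)
  have "vcat (mat 1) \<phi> *v c = Q *v (matrix_inv Q1 *v c)" for c
  proof -
    have "Q1 *v (matrix_inv Q1 *v c) = c" by (rule matrix_inv_apply(1)) fact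
    then show ?thesis
      unfolding Q1 by (auto simp: vcat_apply \<phi>' Q2 vec_eq_iff split: sum.split)
  qed
  then show "\<phi> \<in> {\<phi>. \<forall>c. 0 \<le> dirac_q (u x z *v (vcat (mat 1) \<phi> *v c))}"
    by (simp add: uQ P)
next
  note uinv = fundamental_invertible[OF x, of z]
  fix \<phi> :: "complex^'m1^'m2"
  assume "\<phi> \<in> {\<phi>. \<forall>c. 0 \<le> dirac_q (u x z *v (vcat (mat 1) \<phi> *v c))}"
  then have \<phi>: "\<And>c. 0 \<le> dirac_q (u x z *v (vcat (mat 1) \<phi> *v c))" by simp
  define P where "P = u x z ** vcat (mat 1) \<phi>"
  have "c = 0" if "P *v c = 0" for c
  proof -
    have "vcat (mat 1) \<phi> *v c = 0"
      using that matrix_inv_apply(2)[OF uinv, of "vcat (mat 1) \<phi> *v c"] by (simp add: P_def)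
    then have "(vcat (mat 1) \<phi> *v c) $ Inl a = 0" for a by simp
    then show ?thesis by (simp add: vcat_apply vec_eq_iff)
  qed
  then have P: "nonsingular_j_at P"
    unfolding nonsingular_j_at_def pos_def_gram_iff pos_semidef_dirac_iff using \<phi> by (simp add: P_def)
  then have "nonsingular_property_j (\<lambda>_. P)" "non_exceptional (\<lambda>_. P) z"
    by (auto simp: nonsingular_property_j_def non_exceptional_def)
  moreover have "weyl_transform u x z (\<lambda>_. P) = \<phi>"
  proof -
    have "matrix_inv (u x z) ** P = vcat (mat 1) \<phi>"
      using matrix_inv_mult(2)[OF uinv] by (simp add: P_def matrix_mul_assoc)
    then have "hcat (mat 1) 0 ** matrix_inv (u x z) ** P = mat 1"
        "hcat 0 (mat 1) ** matrix_inv (u x z) ** P = \<phi>"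
      by (simp_all add: hcat_vcat bounded_bilinear.zero_left[OF bounded_bilinear_matrix_mult]
          flip: matrix_mul_assoc)
    then show ?thesis
      by (simp add: weyl_transform_def matrix_inv_unique)
  qed
  ultimately show "\<phi> \<in> weyl_set u x z" unfolding weyl_set_def by blast
qed

text \<open>
  The difference of two Weyl solutions is square integrable on the half-line. Its first block
  vanishes at the origin, so monotonicity of the \<open>j\<close>-form keeps its norm away from zero
  unless it vanishes identically.
\<close>

lemma weyl_point_unique:
  assumes z: "0 < Im z"
    and \<phi>: "\<And>x. 0 \<le> x \<Longrightarrow> \<phi> \<in> weyl_set u x z" and \<psi>: "\<And>x. 0 \<le> x \<Longrightarrow> \<psi> \<in> weyl_set u x z"
  shows "\<phi> = \<psi>"
proof (rule matrix_eqI)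
  fix c
  define y1 where "y1 x = u x z *v (vcat (mat 1) \<phi> *v c)" for x
  define y2 where "y2 x = u x z *v (vcat (mat 1) \<psi> *v c)" for x
  define d where "d x = y1 x - y2 x" for x
  have sol: "dirac_solution v z y1" "dirac_solution v z y2" "dirac_solution v z d"
    unfolding y1_def y2_def d_def by (intro dirac_solution_diff fundamental_apply_solution)+
  have nonneg: "0 \<le> dirac_q (y1 x)" "0 \<le> dirac_q (y2 x)" if "0 \<le> x" for x
    using \<phi>[OF that] \<psi>[OF that] that z by (auto simp: weyl_set_eq y1_def y2_def)
  define D where "D = (norm (\<phi> *v c - \<psi> *v c))\<^sup>2"
  have "(\<chi> b. (\<phi> *v c) $ b - (\<psi> *v c) $ b) = \<phi> *v c - \<psi> *v c"
    by (simp add: vec_eq_iff)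
  then have d0: "dirac_q (d 0) = - D"
    by (simp add: d_def y1_def y2_def vcat_apply_diff dirac_form D_def flip: zero_vec_def)
  have d_ge: "D \<le> (norm (d x))\<^sup>2" if "0 \<le> x" for x
  proof -
    have "- (norm (d x))\<^sup>2 \<le> dirac_q (d x)"
      unfolding norm_block[of "d x"] dirac_form by simp
    with dirac_q_decreasing[OF sol(3) that] z d0 show ?thesis by simp
  qed
  have upper: "- dirac_q (d x) \<le> 2 * dirac_q (y1 0) + 2 * dirac_q (y2 0) + D" if "0 \<le> x" for x
  proof -
    \<comment> \<open>By the parallelogram law for the quadratic form, \<open>G x\<close> is
      \<open>- dirac_q (y1 x + y2 x)\<close>, which increases because the sum is again a
      solution.\<close>
    define G where "G x = dirac_q (d x) - (2 * dirac_q (y1 x) + 2 * dirac_q (y2 x))" for x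
    have "(G has_vector_derivative (- 2 * Im z * (norm (d x))\<^sup>2 -
        (2 * (- 2 * Im z * (norm (y1 x))\<^sup>2) + 2 * (- 2 * Im z * (norm (y2 x))\<^sup>2)))) (at x within {0..})"
      if "0 \<le> x" for x
      unfolding G_def
      by (intro has_vector_derivative_diff has_vector_derivative_add has_vector_derivative_mult_right
          dirac_q_derivative[OF sol(1)] dirac_q_derivative[OF sol(2)] dirac_q_derivative[OF sol(3)] that)
    moreover have "0 \<le> - 2 * Im z * (norm (d x))\<^sup>2 -
        (2 * (- 2 * Im z * (norm (y1 x))\<^sup>2) + 2 * (- 2 * Im z * (norm (y2 x))\<^sup>2))" for x
    proof -
      have "2 * (norm (y1 x))\<^sup>2 + 2 * (norm (y2 x))\<^sup>2 - (norm (d x))\<^sup>2 = (norm (y1 x + y2 x))\<^sup>2"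
        unfolding d_def power2_norm_eq_inner
        by (simp add: inner_simps inner_commute)
      then have "0 \<le> 2 * Im z * (2 * (norm (y1 x))\<^sup>2 + 2 * (norm (y2 x))\<^sup>2 - (norm (d x))\<^sup>2)"
        using z by simp
      then show ?thesis by (simp add: algebra_simps)
    qed
    ultimately have "G 0 \<le> G x" using that by (rule halfline_mono)
    then show ?thesis using nonneg[OF that] by (simp add: G_def d0)
  qed
  \<comment> \<open>The derivative of \<open>- dirac_q (d x)\<close> is
    \<open>2 * Im z * (norm (d x))\<^sup>2\<close>, at least \<open>2 * Im z * D\<close> by
    \<open>d_ge\<close>; this forces linear growth against the bound \<open>upper\<close>.\<close>
  have lower: "2 * Im z * D * x \<le> - dirac_q (d x)" if "0 \<le> x" for x
  proof -
    have "- dirac_q (d 0) - 2 * Im z * D * 0 \<le> - dirac_q (d x) - 2 * Im z * D * x"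
    proof (rule halfline_mono[of "\<lambda>x. - dirac_q (d x) - 2 * Im z * D * x"])
      fix x :: real assume x: "0 \<le> x"
      show "((\<lambda>x. - dirac_q (d x) - 2 * Im z * D * x) has_vector_derivative
          (- (- 2 * Im z * (norm (d x))\<^sup>2) - 2 * Im z * D * 1)) (at x within {0..})"
        by (intro has_vector_derivative_diff has_vector_derivative_mult_right
            has_vector_derivative_minus dirac_q_derivative[OF sol(3) x] has_vector_derivative_id)
      show "0 \<le> - (- 2 * Im z * (norm (d x))\<^sup>2) - 2 * Im z * D * 1"
        using d_ge[OF x] z by (simp add: mult_left_mono)
    qed (fact that)
    then show ?thesis by (simp add: d0 D_def) (smt (verit) zero_le_power2)
  qed
  define C where "C = 2 * dirac_q (y1 0) + 2 * dirac_q (y2 0) + D"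
  have C: "2 * Im z * D * x \<le> C" if "0 \<le> x" for x
    using lower[OF that] upper[OF that] by (simp add: C_def)
  have "D = 0"
  proof (rule ccontr)
    assume "D \<noteq> 0"
    then have pos: "0 < 2 * Im z * D" using z by (simp add: D_def)
    \<comment> \<open>At this point the linear lower bound equals \<open>\<bar>C\<bar> + 1\<close>,
      which exceeds \<open>C\<close>.\<close>
    have "2 * Im z * D * ((\<bar>C\<bar> + 1) / (2 * Im z * D)) \<le> C" by (rule C) (use pos in simp)
    then show False using pos z \<open>D \<noteq> 0\<close> by simp
  qed
  then show "\<phi> *v c = \<psi> *v c" by (simp add: D_def)
qed

end

subsection \<open>Generalized pseudo-exponential potentials\<close>

lemma hcat_of_vcat: "hcat (vcat A B) (vcat C D) = vcat (hcat A C) (hcat B D)"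
  by (auto simp: hcat_def vcat_def vec_eq_iff split: sum.split)

lemma dirac_j_mult_vcat: "dirac_j ** vcat C D = vcat C (- D)"
  by (rule matrix_eqI) (auto simp: dirac_j_apply vcat_apply vec_eq_iff split: sum.split)

lemma hcat_mult_dirac_j: "hcat C D ** dirac_j = hcat C (- D)"
proof (rule matrix_eqI)
  fix x :: "complex^('a + 'b)"
  have "(\<chi> b. - x $ Inr b) = - (\<chi> b. x $ Inr b)" by (simp add: vec_eq_iff)
  then show "(hcat C D ** dirac_j) *v x = hcat C (- D) *v x"
    by (simp add: dirac_j_apply hcat_apply)
qed

text \<open>Evaluate the identity at \<open>p\<close> and pair with \<open>\<i> *s p\<close>. The
  two products with \<open>A\<close> contribute opposite values, whence the factor one half.\<close>

lemma lyapunov_inner: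
  assumes "A ** S - S ** A\<^sup>\<dagger> = cscale \<i> (L ** dirac_j ** L\<^sup>\<dagger>)" "S\<^sup>\<dagger> = S"
  shows "(A *v (S *v p)) \<bullet> (\<i> *s p) = dirac_q (L\<^sup>\<dagger> *v p) / 2"
proof -
  have "(A ** S - S ** A\<^sup>\<dagger>) *v p = cscale \<i> (L ** dirac_j ** L\<^sup>\<dagger>) *v p" by (simp only: assms)
  then have eq: "A *v (S *v p) = S *v (A\<^sup>\<dagger> *v p) + \<i> *s (L *v (dirac_j *v (L\<^sup>\<dagger> *v p)))"
    by (simp add: matrix_vector_mult_diff_rdistrib algebra_simps)
  have 1: "(S *v (A\<^sup>\<dagger> *v p)) \<bullet> (\<i> *s p) = - ((A *v (S *v p)) \<bullet> (\<i> *s p))"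
  proof -
    have "(S *v (A\<^sup>\<dagger> *v p)) \<bullet> (\<i> *s p) = p \<bullet> (\<i> *s (A *v (S *v p)))"
      by (simp add: inner_apply_left assms(2))
    also have "\<dots> = - ((A *v (S *v p)) \<bullet> (\<i> *s p))"
      by (simp add: inner_commute[of p] inner_cscale_left)
    finally show ?thesis .
  qed
  have 2: "(\<i> *s (L *v (dirac_j *v (L\<^sup>\<dagger> *v p)))) \<bullet> (\<i> *s p) = dirac_q (L\<^sup>\<dagger> *v p)"
    by (simp add: inner_cscale_left inner_apply_left)
  have "(A *v (S *v p)) \<bullet> (\<i> *s p) =
      (S *v (A\<^sup>\<dagger> *v p) + \<i> *s (L *v (dirac_j *v (L\<^sup>\<dagger> *v p)))) \<bullet> (\<i> *s p)"
    by (simp only: eq)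
  then show ?thesis unfolding inner_add_left 1 2 by simp
qed

text \<open>The part with \<open>Re z\<close> vanishes by \<open>inner_i_hermitian\<close>, leaving
  the imaginary part times the real form of \<open>S\<close>.\<close>

lemma hermitian_scaled_inner:
  assumes "S\<^sup>\<dagger> = S"
  shows "(z *s (S *v p)) \<bullet> (\<i> *s p) = Im z * (p \<bullet> (S *v p))"
proof -
  have "cnj z * \<i> = of_real (Im z) + of_real (Re z) * \<i>" by (simp add: complex_eq_iff)
  then have "(cnj z * \<i>) *s p = Im z *\<^sub>R p + Re z *\<^sub>R (\<i> *s p)"
    by (simp only: vec.scale_left_distrib cscale_real flip: vec.scale_scale)
  then have "(z *s (S *v p)) \<bullet> (\<i> *s p) = Im z * ((S *v p) \<bullet> p) + Re z * ((S *v p) \<bullet> (\<i> *s p))"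
    by (simp add: inner_cscale_left inner_add_right)
  also have "(S *v p) \<bullet> (\<i> *s p) = 0"
    using inner_i_hermitian[OF assms, of p] by (simp add: inner_apply_left assms)
  finally show ?thesis by (simp add: inner_commute)
qed

lemmas has_vector_derivative_matrix_mult =
  bounded_bilinear.has_vector_derivative[OF bounded_bilinear_matrix_mult]

lemmas has_vector_derivative_matrix_apply =
  bounded_bilinear.has_vector_derivative[OF bounded_bilinear_matrix_apply]

lemmas has_vector_derivative_scale =
  bounded_bilinear.has_vector_derivative[OF bounded_bilinear_scale]

lemmas has_vector_derivative_cscale =
  bounded_linear.has_vector_derivative[OF bounded_linear_cscale]

lemmas has_vector_derivative_ctranspose =
  bounded_linear.has_vector_derivative[OF bounded_linear_ctranspose]

section \<open>Generating matrices and their Lyapunov identity along the half-line\<close>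

locale gpe =
  fixes \<alpha> \<Sigma>0 :: "complex^'n^'n" and \<theta>1 :: "complex^'m1^'n" and \<theta>2 :: "complex^'m2^'n"
  assumes \<Sigma>0: "pos_def \<Sigma>0"
    and lyapunov_0: "\<alpha> ** \<Sigma>0 - \<Sigma>0 ** \<alpha>\<^sup>\<dagger> = cscale \<i> (\<theta>1 ** \<theta>1\<^sup>\<dagger> - \<theta>2 ** \<theta>2\<^sup>\<dagger>)"
begin

abbreviation "\<Lambda> \<equiv> gpe_Lambda \<alpha> \<theta>1 \<theta>2"
abbreviation "\<Sigma> \<equiv> gpe_Sigma \<alpha> \<Sigma>0 \<theta>1 \<theta>2"
abbreviation "S x \<equiv> matrix_inv (\<Sigma> x)"
abbreviation "E x \<equiv> mat_exp (cscale (- \<i> * of_real x) \<alpha>)"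

lemma Lambda_0: "\<Lambda> 0 = hcat \<theta>1 \<theta>2"
  by (simp add: gpe_Lambda_def)

lemma Sigma_0: "\<Sigma> 0 = \<Sigma>0"
  by (simp add: gpe_Sigma_def)

text \<open>The opposite signs in the two exponents are recorded by \<open>dirac_j\<close> on the
  right. Writing \<open>\<Lambda>\<close> as a sum of two products makes the product rule applicable
  to each block.\<close>

lemma Lambda_derivative:
  assumes "0 \<le> x"
  shows "(\<Lambda> has_vector_derivative cscale (- \<i>) (\<alpha> ** \<Lambda> x ** dirac_j)) (at x within {0..})"
proof -
  let ?F = "\<lambda>x. mat_exp (cscale (\<i> * of_real x) \<alpha>)"
  have L: "\<Lambda> x = E x ** hcat \<theta>1 0 + ?F x ** hcat 0 \<theta>2" for x
    by (rule matrix_eqI)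
       (simp add: gpe_Lambda_def hcat_apply matrix_vector_mult_add_rdistrib)
  have "((\<lambda>x. E x ** hcat \<theta>1 0 + ?F x ** hcat 0 \<theta>2) has_vector_derivative
      (E x ** 0 + (cscale (- \<i>) \<alpha> ** E x) ** hcat \<theta>1 0) +
      (?F x ** 0 + (cscale \<i> \<alpha> ** ?F x) ** hcat 0 \<theta>2)) (at x within {0..})"
    by (intro has_vector_derivative_add has_vector_derivative_matrix_mult
        has_vector_derivative_mat_exp has_vector_derivative_const assms)
  also have "(E x ** 0 + (cscale (- \<i>) \<alpha> ** E x) ** hcat \<theta>1 0) +
      (?F x ** 0 + (cscale \<i> \<alpha> ** ?F x) ** hcat 0 \<theta>2) = cscale (- \<i>) (\<alpha> ** \<Lambda> x ** dirac_j)"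
  proof (rule matrix_eqI)
    fix h :: "complex^('m1 + 'm2)"
    have "(\<chi> b. - h $ Inr b) = - (\<chi> b. h $ Inr b)" by (simp add: vec_eq_iff)
    then have "hcat \<theta>1 0 *v (dirac_j *v h) = hcat \<theta>1 0 *v h"
      "hcat 0 \<theta>2 *v (dirac_j *v h) = - (hcat 0 \<theta>2 *v h)"
      by (simp_all add: hcat_apply dirac_j_apply)
    then show "((E x ** 0 + (cscale (- \<i>) \<alpha> ** E x) ** hcat \<theta>1 0) +
      (?F x ** 0 + (cscale \<i> \<alpha> ** ?F x) ** hcat 0 \<theta>2)) *v h =
      cscale (- \<i>) (\<alpha> ** \<Lambda> x ** dirac_j) *v h"
      by (simp add: L matrix_vector_mult_add_rdistrib matrix_vector_mult_diff_distrib
          vec.scale_right_diff_distrib)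
  qed
  finally show ?thesis by (simp add: L[abs_def])
qed

lemma Lambda_ctranspose_derivative:
  assumes "0 \<le> x"
  shows "((\<lambda>x. (\<Lambda> x)\<^sup>\<dagger>) has_vector_derivative cscale \<i> (dirac_j ** (\<Lambda> x)\<^sup>\<dagger> ** \<alpha>\<^sup>\<dagger>)) (at x within {0..})"
  using has_vector_derivative_ctranspose[OF Lambda_derivative[OF assms]]
  by (simp add: ctranspose_mult matrix_mul_assoc)

lemma continuous_on_Lambda: "continuous_on {0..} \<Lambda>" "continuous_on {0..} (\<lambda>x. (\<Lambda> x)\<^sup>\<dagger>)"
  unfolding continuous_on_eq_continuous_within
  using has_vector_derivative_continuous[OF Lambda_derivative]
    has_vector_derivative_continuous[OF Lambda_ctranspose_derivative] by auto

lemma Sigma_derivative: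
  assumes "0 \<le> x"
  shows "(\<Sigma> has_vector_derivative \<Lambda> x ** (\<Lambda> x)\<^sup>\<dagger>) (at x within {0..})"
proof -
  have "continuous_on {0..} (\<lambda>x. \<Lambda> x ** (\<Lambda> x)\<^sup>\<dagger>)"
    by (intro bounded_bilinear.continuous_on[OF bounded_bilinear_matrix_mult] continuous_on_Lambda)
  from has_vector_derivative_add[OF has_vector_derivative_const halfline_integral_derivative[OF this assms]]
  show ?thesis unfolding gpe_Sigma_def[abs_def] by simp
qed

lemma Sigma_hermitian:
  assumes "0 \<le> x"
  shows "(\<Sigma> x)\<^sup>\<dagger> = \<Sigma> x"
proof -
  have "\<Sigma> x - (\<Sigma> x)\<^sup>\<dagger> = \<Sigma> 0 - (\<Sigma> 0)\<^sup>\<dagger>"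
  proof (rule halfline_constant[of "\<lambda>x. \<Sigma> x - (\<Sigma> x)\<^sup>\<dagger>"])
    fix t :: real assume "0 \<le> t"
    from has_vector_derivative_diff[OF Sigma_derivative has_vector_derivative_ctranspose[OF Sigma_derivative],
        OF this this]
    show "((\<lambda>x. \<Sigma> x - (\<Sigma> x)\<^sup>\<dagger>) has_vector_derivative 0) (at t within {0..})"
      by (simp add: ctranspose_mult)
  qed (fact assms)
  then show ?thesis using \<Sigma>0 by (simp add: Sigma_0 pos_def_def)
qed

text \<open>The form of \<open>\<Sigma>\<close> at a fixed vector has a Gram form as its derivative,
  so it never falls below its positive initial value.\<close>

lemma Sigma_pos_def:
  assumes "0 \<le> x"
  shows "pos_def (\<Sigma> x)"
proof -
  have "h \<bullet> (\<Sigma> 0 *v h) \<le> h \<bullet> (\<Sigma> x *v h)" for h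
  proof (rule halfline_mono[of "\<lambda>x. h \<bullet> (\<Sigma> x *v h)"])
    fix t :: real assume "0 \<le> t"
    have "((\<lambda>x. h \<bullet> (\<Sigma> x *v h)) has_vector_derivative
        (h \<bullet> (\<Sigma> t *v 0 + (\<Lambda> t ** (\<Lambda> t)\<^sup>\<dagger>) *v h) + 0 \<bullet> (\<Sigma> t *v h))) (at t within {0..})"
      by (intro bounded_bilinear.has_vector_derivative[OF bounded_bilinear_inner]
          has_vector_derivative_matrix_apply has_vector_derivative_const Sigma_derivative) fact
    also have "h \<bullet> (\<Sigma> t *v 0 + (\<Lambda> t ** (\<Lambda> t)\<^sup>\<dagger>) *v h) + 0 \<bullet> (\<Sigma> t *v h) =
        ((\<Lambda> t)\<^sup>\<dagger> *v h) \<bullet> ((\<Lambda> t)\<^sup>\<dagger> *v h)"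
      by (simp add: inner_apply_left)
    finally show "((\<lambda>x. h \<bullet> (\<Sigma> x *v h)) has_vector_derivative
        ((\<Lambda> t)\<^sup>\<dagger> *v h) \<bullet> ((\<Lambda> t)\<^sup>\<dagger> *v h)) (at t within {0..})" .
  qed (use assms in auto)
  then show ?thesis
    using \<Sigma>0 Sigma_hermitian[OF assms] unfolding pos_def_def Re_sesq_form Sigma_0
    by (auto intro: less_le_trans)
qed

lemma Sigma_invertible: "0 \<le> x \<Longrightarrow> invertible (\<Sigma> x)"
  by (intro pos_def_invertible Sigma_pos_def)

lemma S_derivative:
  assumes "0 \<le> x"
  shows "(S has_vector_derivative - (S x ** (\<Lambda> x ** (\<Lambda> x)\<^sup>\<dagger>) ** S x)) (at x within {0..})"
  using assms Sigma_invertible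
  by (intro has_vector_derivative_matrix_inv Sigma_derivative) auto

text \<open>Both sides have the derivative \<open>\<alpha> \<Lambda> \<Lambda>\<^sup>\<dagger> -
  \<Lambda> \<Lambda>\<^sup>\<dagger> \<alpha>\<^sup>\<dagger>\<close> and agree at the origin by
  hypothesis.\<close>

lemma lyapunov:
  assumes "0 \<le> x"
  shows "\<alpha> ** \<Sigma> x - \<Sigma> x ** \<alpha>\<^sup>\<dagger> = cscale \<i> (\<Lambda> x ** dirac_j ** (\<Lambda> x)\<^sup>\<dagger>)"
proof -
  define f where "f x = \<alpha> ** \<Sigma> x - \<Sigma> x ** \<alpha>\<^sup>\<dagger> - cscale \<i> (\<Lambda> x ** dirac_j ** (\<Lambda> x)\<^sup>\<dagger>)" for x
  have "f x = f 0"
  proof (rule halfline_constant)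
    fix t :: real assume t: "0 \<le> t"
    let ?L = "\<Lambda> t" and ?L' = "cscale (- \<i>) (\<alpha> ** \<Lambda> t ** dirac_j)"
    let ?M' = "cscale \<i> (dirac_j ** (\<Lambda> t)\<^sup>\<dagger> ** \<alpha>\<^sup>\<dagger>)"
    have "(f has_vector_derivative
        (\<alpha> ** (?L ** ?L\<^sup>\<dagger>) + 0 ** \<Sigma> t) - (\<Sigma> t ** 0 + (?L ** ?L\<^sup>\<dagger>) ** \<alpha>\<^sup>\<dagger>) -
        cscale \<i> ((?L ** dirac_j) ** ?M' + (?L ** 0 + ?L' ** dirac_j) ** ?L\<^sup>\<dagger>)) (at t within {0..})"
      unfolding f_def
      by (intro has_vector_derivative_diff has_vector_derivative_cscale
          has_vector_derivative_matrix_mult has_vector_derivative_const Sigma_derivative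
          Lambda_derivative Lambda_ctranspose_derivative t)
    also have "(\<alpha> ** (?L ** ?L\<^sup>\<dagger>) + 0 ** \<Sigma> t) - (\<Sigma> t ** 0 + (?L ** ?L\<^sup>\<dagger>) ** \<alpha>\<^sup>\<dagger>) -
        cscale \<i> ((?L ** dirac_j) ** ?M' + (?L ** 0 + ?L' ** dirac_j) ** ?L\<^sup>\<dagger>) = 0"
      by (rule matrix_eqI)
         (simp add: matrix_vector_mult_add_rdistrib matrix_vector_mult_diff_rdistrib
          vec.scale_right_distrib)
    finally show "(f has_vector_derivative 0) (at t within {0..})" .
  qed (fact assms)
  also have "f 0 = 0"
    by (simp add: f_def Sigma_0 Lambda_0 lyapunov_0 hcat_mult_dirac_j ctranspose_hcat hcat_vcat
        bounded_bilinear.minus_left[OF bounded_bilinear_matrix_mult])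
  finally show ?thesis by (simp add: f_def)
qed

text \<open>The commutator with \<open>dirac_j\<close> removes the diagonal blocks of
  \<open>X\<close> and doubles the others up to sign. The upper one is the potential up to the
  factor \<open>- 2 * \<i>\<close>, the lower one its adjoint since \<open>S x\<close> is
  Hermitian.\<close>

lemma dirac_V_potential:
  assumes "0 \<le> x"
  defines "X \<equiv> (\<Lambda> x)\<^sup>\<dagger> ** S x ** \<Lambda> x"
  shows "dirac_V (gpe_potential \<alpha> \<Sigma>0 \<theta>1 \<theta>2 x) = cscale (- \<i>) (dirac_j ** X - X ** dirac_j)"
proof -
  define A where "A = E x ** \<theta>1"
  define B where "B = mat_exp (cscale (\<i> * of_real x) \<alpha>) ** \<theta>2"
  have L: "\<Lambda> x = hcat A B" by (simp add: gpe_Lambda_def A_def B_def)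
  have S: "(S x)\<^sup>\<dagger> = S x"
    using Sigma_invertible Sigma_hermitian assms by (intro ctranspose_matrix_inv)
  have v: "gpe_potential \<alpha> \<Sigma>0 \<theta>1 \<theta>2 x = cscale (- 2 * \<i>) (A\<^sup>\<dagger> ** S x ** B)"
    by (simp add: gpe_potential_def A_def B_def ctranspose_mult ctranspose_mat_exp matrix_mul_assoc)
  have X: "X = vcat (hcat (A\<^sup>\<dagger> ** S x ** A) (A\<^sup>\<dagger> ** S x ** B)) (hcat (B\<^sup>\<dagger> ** S x ** A) (B\<^sup>\<dagger> ** S x ** B))"
    by (simp add: X_def L ctranspose_hcat vcat_mult mult_hcat hcat_of_vcat)
  have v': "(gpe_potential \<alpha> \<Sigma>0 \<theta>1 \<theta>2 x)\<^sup>\<dagger> = cscale (2 * \<i>) (B\<^sup>\<dagger> ** S x ** A)"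
    by (simp add: v ctranspose_mult S matrix_mul_assoc)
  show ?thesis
    unfolding dirac_V_def v' unfolding v X dirac_j_mult_vcat vcat_mult hcat_mult_dirac_j
    by (auto simp: vcat_def hcat_def cscale_def vec_eq_iff split: sum.split)
qed

text \<open>The commutator formula exhibits the potential as continuous, so linear existence applies
  at each \<open>z\<close> separately.\<close>

lemma fundamental_solution_exists: "\<exists>u. dirac_fundamental_solution (gpe_potential \<alpha> \<Sigma>0 \<theta>1 \<theta>2) u"
proof -
  let ?V = "\<lambda>x. dirac_V (gpe_potential \<alpha> \<Sigma>0 \<theta>1 \<theta>2 x)"
  let ?X = "\<lambda>x. (\<Lambda> x)\<^sup>\<dagger> ** S x ** \<Lambda> x"
  note cont_mult = bounded_bilinear.continuous_on[OF bounded_bilinear_matrix_mult]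
  have "continuous_on {0..} S"
    unfolding continuous_on_eq_continuous_within
    using has_vector_derivative_continuous[OF S_derivative] by auto
  then have X: "continuous_on {0..} ?X"
    by (intro cont_mult continuous_on_Lambda)
  have "continuous_on {0..} (\<lambda>x. cscale (- \<i>) (dirac_j ** ?X x - ?X x ** dirac_j))"
    by (intro bounded_linear.continuous_on[OF bounded_linear_cscale] continuous_on_diff cont_mult
        continuous_on_const X)
  then have V: "continuous_on {0..} ?V"
    by (rule continuous_on_eq) (simp add: dirac_V_potential)
  have "continuous_on {0..} (\<lambda>x. cscale \<i> (cscale z dirac_j + dirac_j ** ?V x))" for z
    by (intro bounded_linear.continuous_on[OF bounded_linear_cscale] continuous_on_add cont_mult
        continuous_on_const V)
  from linear_ode_solution_exists[OF bounded_bilinear_matrix_mult this, of "mat 1"]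
  have "\<forall>z. \<exists>Y. Y 0 = mat 1 \<and> (\<forall>x\<ge>0. (Y has_vector_derivative
      cscale \<i> (cscale z dirac_j + dirac_j ** ?V x) ** Y x) (at x within {0..}))" by blast
  then obtain Y where "\<And>z. Y z 0 = mat 1 \<and> (\<forall>x\<ge>0. (Y z has_vector_derivative
      cscale \<i> (cscale z dirac_j + dirac_j ** ?V x) ** Y z x) (at x within {0..}))" by metis
  then have "dirac_fundamental_solution (gpe_potential \<alpha> \<Sigma>0 \<theta>1 \<theta>2) (\<lambda>x z. Y z x)"
    unfolding dirac_fundamental_solution_def by blast
  then show ?thesis by (intro exI[of _ "\<lambda>x z. Y z x"])
qed

end

section \<open>Explicit solutions and the Weyl point\<close>

context gpe
begin

text \<open>
  Away from the eigenvalues of \<open>\<alpha>\<close>, \<open>u(x,z) = w(x,z) e\<^bsup>ixzj\<^esup> w(0,z)\<^sup>-\<^sup>1\<close> with the transfer function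
  \<open>w(x,z) = I - \<i> j \<Lambda>\<^sup>\<dagger> S (\<alpha> - z)\<^sup>-\<^sup>1 \<Lambda>\<close>, and \<open>y0\<close> below is \<open>w(x,z)\<close> applied to the vector with blocks
  \<open>k\<close> and \<open>0\<close>. Prescribing \<open>q\<close>, which plays the role of \<open>(\<alpha> - z)\<^sup>-\<^sup>1 \<theta>1 k\<close>, avoids inverting \<open>\<alpha> - z\<close>
  and so covers the eigenvalues of \<open>\<alpha>\<close> in the upper half-plane too.
\<close>

context
  fixes z :: complex and q :: "complex^'n" and k :: "complex^'m1"
  assumes q: "\<alpha> *v q = z *s q + \<theta>1 *v k"
begin

definition "top_vec = (vcat (mat 1) 0 *v k :: complex^('m1 + 'm2))"
definition "g x = E x *v q"
definition "p x = S x *v g x"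
definition "y0 x = top_vec - \<i> *s (dirac_j *v ((\<Lambda> x)\<^sup>\<dagger> *v p x))"

lemma dirac_j_top_vec: "dirac_j *v top_vec = top_vec"
  by (auto simp: top_vec_def dirac_j_apply vcat_apply vec_eq_iff split: sum.split)

lemma alpha_E: "\<alpha> *v (E x *v h) = E x *v (\<alpha> *v h)"
proof -
  have "\<alpha> ** E x = E x ** \<alpha>"
    by (rule mat_exp_commute, rule matrix_eqI) simp
  then show ?thesis by (metis mult_apply)
qed

text \<open>Thus \<open>g x\<close> stands in for \<open>(\<alpha> - z)\<^sup>-\<^sup>1\<close>
  applied to \<open>\<Lambda> x *v top_vec\<close>; the relation persists because \<open>E x\<close>
  commutes with \<open>\<alpha>\<close>.\<close>

lemma alpha_g: "\<alpha> *v g x = z *s g x + \<Lambda> x *v top_vec"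
proof -
  have "\<Lambda> x *v top_vec = E x *v (\<theta>1 *v k)"
    by (simp add: gpe_Lambda_def top_vec_def hcat_apply vcat_apply flip: zero_vec_def)
  then show ?thesis
    unfolding g_def alpha_E q by (simp add: matrix_vector_right_distrib)
qed

lemma g_derivative:
  assumes "0 \<le> x"
  shows "(g has_vector_derivative - (\<i> *s (\<alpha> *v g x))) (at x within {0..})"
proof -
  have "((\<lambda>x. E x *v q) has_vector_derivative E x *v 0 + (cscale (- \<i>) \<alpha> ** E x) *v q) (at x within {0..})"
    by (intro has_vector_derivative_matrix_apply has_vector_derivative_const
        has_vector_derivative_mat_exp assms)
  then show ?thesis by (simp add: g_def[abs_def])
qed

lemma Sigma_p: "0 \<le> x \<Longrightarrow> \<Sigma> x *v p x = g x"
  by (simp add: p_def matrix_inv_apply Sigma_invertible)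

lemma dirac_j_y0: "dirac_j *v y0 x = top_vec - \<i> *s ((\<Lambda> x)\<^sup>\<dagger> *v p x)"
  by (simp add: y0_def matrix_vector_mult_diff_distrib dirac_j_top_vec)

text \<open>The Lyapunov identity applied to \<open>p x\<close> trades
  \<open>\<alpha>\<^sup>\<dagger>\<close>, which enters through the derivative of the adjoint of
  \<open>\<Lambda>\<close>, for \<open>z\<close> and \<open>y0 x\<close>.\<close>

lemma alpha_ctranspose_p:
  assumes "0 \<le> x"
  shows "\<alpha>\<^sup>\<dagger> *v p x = z *s p x + S x *v (\<Lambda> x *v y0 x)"
proof -
  have "(\<alpha> ** \<Sigma> x - \<Sigma> x ** \<alpha>\<^sup>\<dagger>) *v p x = cscale \<i> (\<Lambda> x ** dirac_j ** (\<Lambda> x)\<^sup>\<dagger>) *v p x"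
    by (simp only: lyapunov[OF assms])
  then have "\<Sigma> x *v (\<alpha>\<^sup>\<dagger> *v p x) =
      \<alpha> *v (\<Sigma> x *v p x) - \<i> *s (\<Lambda> x *v (dirac_j *v ((\<Lambda> x)\<^sup>\<dagger> *v p x)))"
    by (simp add: matrix_vector_mult_diff_rdistrib algebra_simps)
  also have "\<dots> = z *s (\<Sigma> x *v p x) + \<Lambda> x *v y0 x"
    by (simp add: Sigma_p[OF assms] alpha_g y0_def matrix_vector_mult_diff_distrib)
  finally have "S x *v (\<Sigma> x *v (\<alpha>\<^sup>\<dagger> *v p x)) = S x *v (z *s (\<Sigma> x *v p x) + \<Lambda> x *v y0 x)"
    by simp
  then show ?thesis
    by (simp add: matrix_inv_apply Sigma_invertible assms matrix_vector_right_distrib)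
qed

lemma p_derivative:
  assumes "0 \<le> x"
  shows "(p has_vector_derivative
    - ((\<i> * z) *s p x) - \<i> *s (S x *v (\<Lambda> x *v (dirac_j *v y0 x)))) (at x within {0..})"
proof -
  have "(p has_vector_derivative
      (S x *v (- (\<i> *s (\<alpha> *v g x))) +
       (- (S x ** (\<Lambda> x ** (\<Lambda> x)\<^sup>\<dagger>) ** S x)) *v g x)) (at x within {0..})"
    unfolding p_def[abs_def]
    by (intro has_vector_derivative_matrix_apply g_derivative S_derivative assms)
  also have "S x *v (- (\<i> *s (\<alpha> *v g x))) +
       (- (S x ** (\<Lambda> x ** (\<Lambda> x)\<^sup>\<dagger>) ** S x)) *v g x =
      - ((\<i> * z) *s p x) - \<i> *s (S x *v (\<Lambda> x *v (dirac_j *v y0 x)))"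
    by (simp add: alpha_g dirac_j_y0 matrix_vector_right_distrib matrix_vector_mult_diff_distrib
        vec.scale_right_distrib vec.scale_right_diff_distrib flip: p_def)
  finally show ?thesis .
qed

text \<open>The terms \<open>a\<close> and \<open>b\<close> are \<open>X\<close> applied to
  \<open>y0 x\<close> and to \<open>dirac_j *v y0 x\<close>, with \<open>X\<close> as in
  \<open>dirac_V_potential\<close>; the commutator makes \<open>a - dirac_j *v b\<close> the
  potential term. The extra \<open>- (\<i> * z) *s y0 x\<close> is cancelled by the exponential
  factor in \<open>exp_y0_solution\<close>.\<close>

lemma y0_derivative:
  assumes "0 \<le> x"
  shows "(y0 has_vector_derivative
    (\<i> * z) *s (dirac_j *v y0 x) - (\<i> * z) *s y0 x +
    \<i> *s (dirac_j *v (dirac_V (gpe_potential \<alpha> \<Sigma>0 \<theta>1 \<theta>2 x) *v y0 x))) (at x within {0..})"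
proof -
  let ?L = "\<Lambda> x"
  let ?p' = "- ((\<i> * z) *s p x) - \<i> *s (S x *v (?L *v (dirac_j *v y0 x)))"
  define w where "w = ?L\<^sup>\<dagger> *v p x"
  define a where "a = ?L\<^sup>\<dagger> *v (S x *v (?L *v y0 x))"
  define b where "b = ?L\<^sup>\<dagger> *v (S x *v (?L *v (dirac_j *v y0 x)))"
  have "(y0 has_vector_derivative
      (0 - (\<i> *s (dirac_j *v (?L\<^sup>\<dagger> *v ?p' + cscale \<i> (dirac_j ** ?L\<^sup>\<dagger> ** \<alpha>\<^sup>\<dagger>) *v p x) +
           0 *v (?L\<^sup>\<dagger> *v p x)) + 0 *s (dirac_j *v (?L\<^sup>\<dagger> *v p x))))) (at x within {0..})"
    unfolding y0_def[abs_def]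
    by (intro has_vector_derivative_diff has_vector_derivative_scale
        has_vector_derivative_matrix_apply has_vector_derivative_const
        p_derivative[unfolded y0_def] Lambda_ctranspose_derivative assms)
  also have "0 - (\<i> *s (dirac_j *v (?L\<^sup>\<dagger> *v ?p' + cscale \<i> (dirac_j ** ?L\<^sup>\<dagger> ** \<alpha>\<^sup>\<dagger>) *v p x) +
           0 *v (?L\<^sup>\<dagger> *v p x)) + 0 *s (dirac_j *v (?L\<^sup>\<dagger> *v p x))) =
      z *s w + a - z *s (dirac_j *v w) - dirac_j *v b"
    by (simp add: w_def a_def b_def alpha_ctranspose_p[OF assms] matrix_vector_right_distrib
        matrix_vector_mult_diff_distrib vec.scale_right_distrib vec.scale_right_diff_distrib)
  also have "\<dots> = (\<i> * z) *s (dirac_j *v y0 x) - (\<i> * z) *s y0 x + (a - dirac_j *v b)"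
    unfolding dirac_j_y0 unfolding y0_def w_def[symmetric]
    by (simp add: vec.scale_right_diff_distrib mult_ac)
  also have "a - dirac_j *v b =
      \<i> *s (dirac_j *v (dirac_V (gpe_potential \<alpha> \<Sigma>0 \<theta>1 \<theta>2 x) *v y0 x))"
    by (simp add: dirac_V_potential[OF assms] matrix_vector_mult_diff_rdistrib
        matrix_vector_mult_diff_distrib a_def b_def)
  finally show ?thesis .
qed

lemma exp_y0_solution:
  "dirac_solution (gpe_potential \<alpha> \<Sigma>0 \<theta>1 \<theta>2) z (\<lambda>x. exp (\<i> * z * of_real x) *s y0 x)"
  unfolding dirac_solution_def
proof (intro allI impI)
  fix x :: real assume x: "0 \<le> x"
  have "((\<lambda>x. exp (\<i> * z * of_real x)) has_vector_derivative \<i> * z * exp (\<i> * z * of_real x))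
      (at x within {0..})"
    by (rule derivative_eq_intros has_vector_derivative_real_field refl | simp)+
  from has_vector_derivative_scale[OF this y0_derivative[OF x]]
  show "((\<lambda>x. exp (\<i> * z * of_real x) *s y0 x) has_vector_derivative
      (\<i> * z) *s (dirac_j *v (exp (\<i> * z * of_real x) *s y0 x)) +
      \<i> *s (dirac_j *v (dirac_V (gpe_potential \<alpha> \<Sigma>0 \<theta>1 \<theta>2 x) *v (exp (\<i> * z * of_real x) *s y0 x))))
      (at x within {0..})"
    by (simp add: vec.scale_right_distrib vec.scale_right_diff_distrib mult_ac)
qed

text \<open>In the expansion of the form, the Lyapunov identity evaluates the two equal cross terms,
  and their \<open>dirac_q w\<close> parts cancel against the quadratic term.\<close>

lemma dirac_q_y0:
  assumes "0 \<le> x"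
  shows "dirac_q (y0 x) = (norm top_vec)\<^sup>2 + 2 * Im z * (p x \<bullet> (\<Sigma> x *v p x))"
proof -
  define w where "w = (\<Lambda> x)\<^sup>\<dagger> *v p x"
  have ew: "top_vec \<bullet> (\<i> *s w) = dirac_q w / 2 - Im z * (p x \<bullet> (\<Sigma> x *v p x))"
  proof -
    have "top_vec \<bullet> (\<i> *s w) = (\<Lambda> x *v top_vec) \<bullet> (\<i> *s p x)"
      by (simp add: w_def inner_apply_left)
    also have "\<Lambda> x *v top_vec = \<alpha> *v (\<Sigma> x *v p x) - z *s (\<Sigma> x *v p x)"
      by (simp add: Sigma_p[OF assms] alpha_g)
    also have "\<dots> \<bullet> (\<i> *s p x) = dirac_q w / 2 - Im z * (p x \<bullet> (\<Sigma> x *v p x))"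
      unfolding inner_diff_left w_def
      by (simp only: lyapunov_inner[OF lyapunov[OF assms] Sigma_hermitian[OF assms]]
          hermitian_scaled_inner[OF Sigma_hermitian[OF assms]])
    finally show ?thesis .
  qed
  have "(\<i> *s (dirac_j *v w)) \<bullet> top_vec = top_vec \<bullet> (\<i> *s w)"
  proof -
    have "(\<i> *s (dirac_j *v w)) \<bullet> top_vec = (dirac_j *v (\<i> *s w)) \<bullet> top_vec" by simp
    also have "\<dots> = (\<i> *s w) \<bullet> top_vec" by (simp only: inner_dirac_j(2) dirac_j_top_vec)
    finally show ?thesis by (simp only: inner_commute)
  qed
  moreover have "(\<i> *s (dirac_j *v w)) \<bullet> (\<i> *s w) = dirac_q w"
    by (simp add: inner_cscale_left inner_dirac_j(2))
  moreover have "dirac_q (y0 x) = (top_vec - \<i> *s (dirac_j *v w)) \<bullet> (top_vec - \<i> *s w)"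
    unfolding dirac_j_y0 unfolding y0_def w_def ..
  ultimately show ?thesis
    by (simp add: inner_diff_left inner_diff_right ew power2_norm_eq_inner)
qed

lemma dirac_q_exp_y0:
  assumes "0 \<le> x" "0 \<le> Im z"
  shows "0 \<le> dirac_q (exp (\<i> * z * of_real x) *s y0 x)"
proof -
  have "0 \<le> p x \<bullet> (\<Sigma> x *v p x)"
    using Sigma_pos_def[OF assms(1)] unfolding pos_def_def Re_sesq_form
    by (cases "p x = 0") (auto intro: less_imp_le)
  then have "0 \<le> dirac_q (y0 x)"
    using assms by (simp add: dirac_q_y0)
  moreover have "dirac_q (c *s h) = (cmod c)\<^sup>2 * dirac_q h" for c and h :: "complex^('m1 + 'm2)"
  proof -
    have "dirac_q (c *s h) = h \<bullet> ((cnj c * c) *s (dirac_j *v h))"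
      by (simp add: inner_cscale_left)
    also have "cnj c * c = of_real ((cmod c)\<^sup>2)"
      by (simp add: complex_norm_square mult.commute del: of_real_power)
    finally show ?thesis by (simp only: cscale_real inner_scaleR_right)
  qed
  ultimately show ?thesis by simp
qed

end

text \<open>The eigenvalues of \<theta> have nonpositive imaginary part: for an eigenvector
  \<open>\<Sigma>0 *v p\<close>, the Lyapunov identity makes
  \<open>Im z * (p \<bullet> (\<Sigma>0 *v p))\<close> equal to minus half the sum of the squared
  norms of \<open>\<theta>1\<^sup>\<dagger> *v p\<close> and
  \<open>\<theta>2\<^sup>\<dagger> *v p\<close>.\<close>

lemma resolvent_invertible:
  assumes "0 < Im z" and \<theta>: "\<theta> = \<alpha> - cscale \<i> (\<theta>1 ** \<theta>1\<^sup>\<dagger> ** matrix_inv \<Sigma>0)"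
  shows "invertible (mat z - \<theta>)"
proof (rule invertible_if_ker_trivial)
  fix q assume "(mat z - \<theta>) *v q = 0"
  then have zq: "z *s q = \<theta> *v q" by (simp add: matrix_vector_mult_diff_rdistrib)
  define p where "p = matrix_inv \<Sigma>0 *v q"
  have q: "q = \<Sigma>0 *v p"
    using matrix_inv_apply(1)[OF pos_def_invertible[OF \<Sigma>0]] by (simp add: p_def)
  have H: "\<Sigma>0\<^sup>\<dagger> = \<Sigma>0" using \<Sigma>0 by (simp add: pos_def_def)
  have "z *s (\<Sigma>0 *v p) = \<alpha> *v (\<Sigma>0 *v p) - \<i> *s (\<theta>1 *v (\<theta>1\<^sup>\<dagger> *v p))"
    using zq unfolding \<theta> q[symmetric] by (simp add: matrix_vector_mult_diff_rdistrib p_def)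
  then have "Im z * (p \<bullet> (\<Sigma>0 *v p)) =
      (\<alpha> *v (\<Sigma>0 *v p) - \<i> *s (\<theta>1 *v (\<theta>1\<^sup>\<dagger> *v p))) \<bullet> (\<i> *s p)"
    using hermitian_scaled_inner[OF H, of z p] by simp
  also have "\<dots> = dirac_q ((\<Lambda> 0)\<^sup>\<dagger> *v p) / 2 - (\<theta>1\<^sup>\<dagger> *v p) \<bullet> (\<theta>1\<^sup>\<dagger> *v p)"
    unfolding inner_diff_left
    using lyapunov_inner[OF lyapunov[of 0], unfolded Sigma_0, OF _ H, of p]
    by (simp add: inner_cscale_left inner_apply_left)
  also have "dirac_q ((\<Lambda> 0)\<^sup>\<dagger> *v p) = (norm (\<theta>1\<^sup>\<dagger> *v p))\<^sup>2 - (norm (\<theta>2\<^sup>\<dagger> *v p))\<^sup>2"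
    by (simp add: Lambda_0 ctranspose_hcat dirac_form vcat_apply)
  finally have "Im z * (p \<bullet> (\<Sigma>0 *v p)) \<le> 0"
    by (simp add: power2_norm_eq_inner[symmetric])
  then have "p \<bullet> (\<Sigma>0 *v p) \<le> 0" using assms(1) by (simp add: mult_le_0_iff)
  then have "p = 0" using \<Sigma>0 unfolding pos_def_def Re_sesq_form by (meson not_le)
  then show "q = 0" by (simp add: q)
qed

lemma weyl_point_mem:
  assumes fund: "dirac_fundamental_solution (gpe_potential \<alpha> \<Sigma>0 \<theta>1 \<theta>2) u"
    and z: "0 < Im z" and x: "0 \<le> x"
    and \<theta>: "\<theta> = \<alpha> - cscale \<i> (\<theta>1 ** \<theta>1\<^sup>\<dagger> ** matrix_inv \<Sigma>0)"
  shows "cscale (- \<i>) (\<theta>2\<^sup>\<dagger> ** matrix_inv \<Sigma>0 ** matrix_inv (mat z - \<theta>) ** \<theta>1) \<in> weyl_set u x z"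
    (is "?\<phi> \<in> _")
proof -
  have "0 \<le> dirac_q (u x z *v (vcat (mat 1) ?\<phi> *v c))" for c
  proof -
    \<comment> \<open>Matching \<open>y0\<close> at the origin with
      \<open>vcat (mat 1) ?\<phi> *v c\<close> dictates both choices: the first block gives
      \<open>k\<close>, and \<open>\<alpha> *v q = z *s q + \<theta>1 *v k\<close> becomes the
      resolvent equation for \<open>q\<close>. The second block is then
      \<open>?\<phi> *v c\<close>.\<close>
    define q where "q = - (matrix_inv (mat z - \<theta>) *v (\<theta>1 *v c))"
    define k where "k = c + \<i> *s (\<theta>1\<^sup>\<dagger> *v (matrix_inv \<Sigma>0 *v q))"
    have "(mat z - \<theta>) *v q = - (\<theta>1 *v c)"
      using matrix_inv_apply(1)[OF resolvent_invertible[OF z \<theta>]] by (simp add: q_def)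
    then have q: "\<alpha> *v q = z *s q + \<theta>1 *v k"
      unfolding \<theta> k_def
      by (simp add: matrix_vector_mult_diff_rdistrib matrix_vector_right_distrib algebra_simps)
    have y0: "y0 q k 0 = vcat (mat 1) ?\<phi> *v c"
      unfolding y0_def[OF q] p_def[OF q] g_def[OF q] top_vec_def[OF q]
      by (auto simp: Lambda_0 Sigma_0 ctranspose_hcat vcat_apply dirac_j_apply vec_eq_iff k_def q_def
          split: sum.split)
    from dirac_solution_eq_fundamental[OF fund exp_y0_solution[OF q] x]
    have "exp (\<i> * z * of_real x) *s y0 q k x = u x z *v (vcat (mat 1) ?\<phi> *v c)"
      by (simp add: y0)
    then show ?thesis using dirac_q_exp_y0[OF q x] z by simp
  qed
  then show ?thesis using weyl_set_eq[OF fund x, of z] z by simp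
qed

end

theorem theorem3p2:
  fixes \<alpha> \<Sigma>0 \<theta> :: "complex^'n^'n"
    and \<theta>1 :: "complex^'m1^'n"
    and \<theta>2 :: "complex^'m2^'n"
  assumes "pos_def \<Sigma>0"
    and "\<alpha> ** \<Sigma>0 - \<Sigma>0 ** \<alpha>\<^sup>\<dagger> = cscale \<i> (\<theta>1 ** \<theta>1\<^sup>\<dagger> - \<theta>2 ** \<theta>2\<^sup>\<dagger>)"
    and "\<theta> = \<alpha> - cscale \<i> (\<theta>1 ** \<theta>1\<^sup>\<dagger> ** matrix_inv \<Sigma>0)"
  shows "is_weyl_function (gpe_potential \<alpha> \<Sigma>0 \<theta>1 \<theta>2)
           (\<lambda>z. cscale (- \<i>) (\<theta>2\<^sup>\<dagger> ** matrix_inv \<Sigma>0 ** matrix_inv (mat z - \<theta>) ** \<theta>1))"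
proof -
  interpret gpe \<alpha> \<Sigma>0 \<theta>1 \<theta>2 by unfold_locales fact+
  obtain u where u: "dirac_fundamental_solution (gpe_potential \<alpha> \<Sigma>0 \<theta>1 \<theta>2) u"
    using fundamental_solution_exists by blast
  show ?thesis
    unfolding is_weyl_function_def
  proof (intro exI[of _ u] conjI u ballI)
    fix z assume "z \<in> \<complex>\<^sub>+"
    then have z: "0 < Im z" by (simp add: upper_half_plane_def)
    note mem = weyl_point_mem[OF u z _ assms(3)]
    show "{cscale (- \<i>) (\<theta>2\<^sup>\<dagger> ** matrix_inv \<Sigma>0 ** matrix_inv (mat z - \<theta>) ** \<theta>1)} =
        (\<Inter>x\<in>{0..}. weyl_set u x z)"
      using mem weyl_point_unique[OF u z] by (intro equalityI subsetI) auto
  qed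
qed

end
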